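(* There is a constant $c>0$ such that, if $p=p(n)\ge n^{-c}$ (with $p\le 1$), then $$\lim_{n\to\infty}\Pr\left[\text{every maximum triangle-free subgraph of } G_{n,p} \text{ is bipartite}\right]=1.$$
   Context: $G_{n,p}$ is the binomial (Erdős–Rényi) random graph on vertex set $[n]=\{1,\dots,n\}$, in which each of the $\binom n2$ possible edges is present independently with probability $p$. Subgraphs are not necessarily induced. A maximum triangle-free subgraph of a graph $G$ is a triangle-free subgraph of $G$ with the largest possible number of edges. *)

theory Defs
  imports "HOL-Probability.Probability" "HOL-Library.Ramsey"
begin

type_synonym 'a graph = "'a set \<times> 'a set set"

abbreviation verts :: "'a graph \<Rightarrow> 'a set" where
  "verts \<equiv> fst"

abbreviation edges :: "'a graph \<Rightarrow> 'a set set" where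
  "edges \<equiv> snd"

text \<open>\<open>nsets V 2\<close> is the set of all two-element subsets of \<open>V\<close>.\<close>

definition simple_graph :: "'a graph \<Rightarrow> bool" where
  "simple_graph G \<longleftrightarrow> edges G \<subseteq> nsets (verts G) 2"

text \<open>A subgraph need be neither induced nor spanning.\<close>

definition subgraph :: "'a graph \<Rightarrow> 'a graph \<Rightarrow> bool" where
  "subgraph H G \<longleftrightarrow> simple_graph H \<and> verts H \<subseteq> verts G \<and> edges H \<subseteq> edges G"

definition triangle_free :: "'a graph \<Rightarrow> bool" where
  "triangle_free G \<longleftrightarrow>
     \<not> (\<exists>a b c. distinct [a, b, c] \<and> {a, b} \<in> edges G \<and> {b, c} \<in> edges G \<and> {a, c} \<in> edges G)"

definition bipartite :: "'a graph \<Rightarrow> bool" where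
  "bipartite G \<longleftrightarrow>
     (\<exists>X Y. X \<union> Y = verts G \<and> X \<inter> Y = {} \<and> (\<forall>e\<in>edges G. \<exists>x\<in>X. \<exists>y\<in>Y. e = {x, y}))"

definition max_triangle_free_subgraph :: "'a graph \<Rightarrow> 'a graph \<Rightarrow> bool" where
  "max_triangle_free_subgraph H G \<longleftrightarrow>
     is_arg_max (\<lambda>H. card (edges H)) (\<lambda>H. subgraph H G \<and> triangle_free H) H"

text \<open>
  The binomial random graph: every pair \<open>e\<close> of vertices in \<open>{1..n}\<close> carries an independent
  Bernoulli variable \<open>b e\<close> with parameter \<open>p\<close>, and \<open>e\<close> is an edge iff \<open>b e\<close> is true. The second
  argument of \<open>Pi_pmf\<close> is only the value of \<open>b\<close> outside the index set. Meaningful for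
  \<open>0 \<le> p \<le> 1\<close>, since \<open>bernoulli_pmf\<close> clips its parameter to that interval.
\<close>

definition random_graph :: "nat \<Rightarrow> real \<Rightarrow> nat graph pmf" where
  "random_graph n p =
     map_pmf (\<lambda>b. ({1..n}, {e \<in> nsets {1..n} 2. b e}))
       (Pi_pmf (nsets {1..n} 2) False (\<lambda>_. bernoulli_pmf p))"

end

theory Submission
  imports Defs "HOL-Real_Asymp.Real_Asymp"
begin

text \<open>
  Write \<open>p \<ge> q = n powr -c\<close> and let \<open>H\<close> be a maximum triangle-free subgraph of the edge set \<open>E\<close>.
  Since \<open>c\<close> may be tiny, it is enough that every error term is \<open>n\<^sup>2\<close> times a large power of \<open>q\<close>.

  All triangle-free graphs are essentially contained in one of \<open>exp (o(p n\<^sup>2))\<close> graphs with few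
  triangles, so by a union bound the container of \<open>H\<close> has about \<open>n\<^sup>2/4\<close> edges. By stability it is
  almost bipartite, and so is \<open>H\<close>. Let \<open>(A, B)\<close> be a maximum cut of \<open>H\<close>, let \<open>F\<close> be the set of edges of
  \<open>H\<close> inside the parts and \<open>M\<close> the set of edges of \<open>E\<close> across that are missing from \<open>H\<close>. Every common neighbour of the
  ends of an edge of \<open>F\<close> yields an edge of \<open>M\<close>. If \<open>F\<close> contains a large matching, then \<open>M\<close> is much
  larger than \<open>F\<close>; the same holds if \<open>F\<close> has a vertex of large degree, because the cut is maximum and there are
  many edges of \<open>E\<close> between any two large sets. So \<open>F\<close> can outweigh \<open>M\<close> only if both are smaller than some
  power of \<open>1/q\<close>.

  It remains to exclude an edge \<open>xy\<close> in \<open>F\<close> with almost no common neighbour across. Fix all edges except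
  those from \<open>x\<close> to the neighbours of \<open>y\<close>, and take the best cut of this graph with \<open>x\<close>, \<open>y\<close> on the
  same side. The remaining edges are independent of it and increase it by order \<open>q ^ 3 * n\<close>, whereas they
  hardly increase a cut with few common neighbours of \<open>x\<close>, \<open>y\<close> across. So such a cut is far from
  maximum, which a small \<open>F\<close> cannot make up for.
\<close>

subsection \<open>Graphs as edge sets\<close>

definition nbh :: "'a set set \<Rightarrow> 'a \<Rightarrow> 'a set" where
  "nbh E x = {y. {x, y} \<in> E}"

definition cut :: "'a set set \<Rightarrow> 'a set \<Rightarrow> 'a set set" where
  "cut E X = {e \<in> E. e \<inter> X \<noteq> {} \<and> \<not> e \<subseteq> X}"

text \<open>Coinciding vertices would turn one of the three sets into a singleton, so on sets of
  two-element edges distinctness is automatic.\<close>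

definition tri_free :: "'a set set \<Rightarrow> bool" where
  "tri_free E \<longleftrightarrow> (\<forall>x y z. {x, y} \<in> E \<longrightarrow> {x, z} \<in> E \<longrightarrow> {y, z} \<notin> E)"

lemma nbh_iff: "y \<in> nbh E x \<longleftrightarrow> {x, y} \<in> E"
  by (simp add: nbh_def)

lemma nbh_subset: "E \<subseteq> nsets V 2 \<Longrightarrow> nbh E x \<subseteq> V - {x}"
  by (fastforce simp: nbh_iff nsets_def)

lemma finite_nbh: "E \<subseteq> nsets V 2 \<Longrightarrow> finite V \<Longrightarrow> finite (nbh E x)"
  by (meson finite_Diff finite_subset nbh_subset)

lemma finite_edges: "E \<subseteq> nsets V 2 \<Longrightarrow> finite V \<Longrightarrow> finite E"
  by (meson finite_imp_finite_nsets finite_subset)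

lemma edgeE:
  assumes "E \<subseteq> nsets V 2" "e \<in> E"
  obtains x y where "e = {x, y}" "x \<noteq> y" "x \<in> V" "y \<in> V"
  using assms by (meson nsets2_E subsetD)

lemma cut_subset: "cut E X \<subseteq> E"
  by (auto simp: cut_def)

lemma cut_compl: "E \<subseteq> nsets V 2 \<Longrightarrow> X \<subseteq> V \<Longrightarrow> cut E (V - X) = cut E X"
  unfolding cut_def nsets_def by (intro Collect_cong) blast

lemma doubleton_in_cut: "{x, y} \<in> cut E X \<longleftrightarrow> {x, y} \<in> E \<and> (x \<in> X \<longleftrightarrow> y \<notin> X)"
  by (auto simp: cut_def)

lemma tri_free_cut: "tri_free (cut E X)"
  unfolding tri_free_def doubleton_in_cut by metis

lemma card_nsets_le:
  assumes "finite V" shows "real (card (nsets V 2)) \<le> (card V)\<^sup>2 / 2"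
proof -
  have "card (nsets V 2) = card V choose 2" by simp
  also have "real \<dots> = real (card V) * (real (card V) - 1) / 2"
    by (cases "card V") (simp_all add: choose_two real_of_nat_div algebra_simps)
  also have "\<dots> \<le> (card V)\<^sup>2 / 2"
    by (simp add: power2_eq_square algebra_simps)
  finally show ?thesis .
qed

section \<open>Degree counting and stability of edge counts\<close>

lemma card_nbh_edges:
  assumes "E \<subseteq> nsets V 2"
  shows "card (nbh E x) = card {e \<in> E. x \<in> e}"
proof -
  have "bij_betw (\<lambda>y. {x, y}) (nbh E x) {e \<in> E. x \<in> e}"
    unfolding bij_betw_def inj_on_def
  proof safe
    fix e assume e: "e \<in> E" "x \<in> e"
    obtain a b where "e = {a, b}" using assms e(1) by (blast elim: edgeE)
    then show "e \<in> (\<lambda>y. {x, y}) ` nbh E x"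
      using e by (auto simp: nbh_iff insert_commute image_iff)
  qed (auto simp: nbh_iff doubleton_eq_iff)
  then show ?thesis by (rule bij_betw_same_card)
qed

lemma sum_card_incident:
  assumes "finite E" "finite X"
  shows "(\<Sum>x\<in>X. card {e \<in> E. x \<in> e}) = (\<Sum>e\<in>E. card (e \<inter> X))"
proof -
  have "(\<Sum>x\<in>X. card {e \<in> E. x \<in> e}) = (\<Sum>x\<in>X. \<Sum>e\<in>E. if x \<in> e then 1 else 0)"
    using assms by (simp add: sum.If_cases Int_def)
  also have "\<dots> = (\<Sum>e\<in>E. \<Sum>x\<in>X. if x \<in> e then 1 else 0)"
    by (rule sum.swap)
  also have "\<dots> = (\<Sum>e\<in>E. card (e \<inter> X))"
    using assms by (simp add: sum.If_cases Int_def conj_commute)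
  finally show ?thesis .
qed

lemma sum_nbh:
  assumes "E \<subseteq> nsets V 2" "finite V" "X \<subseteq> V"
  shows "(\<Sum>x\<in>X. card (nbh E x)) = (\<Sum>e\<in>E. card (e \<inter> X))"
  using sum_card_incident[of E X] finite_edges[OF assms(1,2)] finite_subset[OF assms(3,2)]
  by (simp add: card_nbh_edges[OF assms(1)])

lemma handshake:
  assumes E: "E \<subseteq> nsets V 2" and "finite V" "X \<subseteq> V"
  shows "(\<Sum>x\<in>X. card (nbh E x \<inter> X)) = 2 * card (E \<inter> Pow X)"
proof -
  have 1: "E \<inter> Pow X \<subseteq> nsets V 2" using E by auto
  have "nbh E x \<inter> X = nbh (E \<inter> Pow X) x" if "x \<in> X" for x
    using that by (auto simp: nbh_iff)
  then have "(\<Sum>x\<in>X. card (nbh E x \<inter> X)) = (\<Sum>x\<in>X. card (nbh (E \<inter> Pow X) x))"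
    by simp
  also have "\<dots> = (\<Sum>e\<in>E \<inter> Pow X. card (e \<inter> X))"
    using sum_nbh[OF 1 assms(2,3)] .
  also have "\<dots> = (\<Sum>e\<in>E \<inter> Pow X. 2)"
  proof (rule sum.cong[OF refl])
    fix e assume e: "e \<in> E \<inter> Pow X"
    then have "e \<inter> X = e" by auto
    moreover have "card e = 2" using e E by (auto simp: nsets_def)
    ultimately show "card (e \<inter> X) = 2" by simp
  qed
  finally show ?thesis by simp
qed

text \<open>Fueredi's stability argument: count the degrees outside the neighbourhood of a vertex of maximum degree.\<close>

lemma edge_count_stability:
  assumes E: "E \<subseteq> nsets V 2" and V: "finite V" and v: "v \<in> V"
    and mx: "\<And>w. w \<in> V \<Longrightarrow> card (nbh E w) \<le> card (nbh E v)"
  defines "A \<equiv> nbh E v"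
  shows "card E + card (E \<inter> Pow (V - A)) \<le> card (E \<inter> Pow A) + card A * card (V - A)"
proof -
  have fE: "finite E" using finite_edges[OF E V] .
  have "card E + card (E \<inter> Pow (V - A)) = (\<Sum>e\<in>E. 1 + (if e \<in> Pow (V - A) then 1 else 0))"
    using fE by (simp only: sum.distrib sum.If_cases) (simp add: Int_def)
  \<comment> \<open>An edge inside \<open>A\<close> has no end in \<open>V - A\<close>, one inside
    \<open>V - A\<close> has two, and every other edge has exactly one.\<close>
  also have "\<dots> \<le> (\<Sum>e\<in>E. (if e \<in> Pow A then 1 else 0) + card (e \<inter> (V - A)))"
  proof (rule sum_mono)
    fix e assume e: "e \<in> E"
    then have ce: "card e = 2" "e \<subseteq> V" "finite e" using E by (auto simp: nsets_def)
    have "e \<inter> (V - A) = e" if "e \<subseteq> V - A" using that by auto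
    moreover have "card (e \<inter> (V - A)) \<ge> 1" if "\<not> e \<subseteq> A"
    proof -
      have "e \<inter> (V - A) \<noteq> {}" using that ce by blast
      then show ?thesis using ce by (simp add: Suc_le_eq card_gt_0_iff)
    qed
    moreover have "e \<noteq> {}" using ce by auto
    ultimately show "1 + (if e \<in> Pow (V - A) then 1 else 0) \<le> (if e \<in> Pow A then 1 else 0) + card (e \<inter> (V - A))"
      using ce by auto
  qed
  also have "\<dots> = card (E \<inter> Pow A) + (\<Sum>x\<in>V - A. card (nbh E x))"
    unfolding sum.distrib sum_nbh[OF E V, of "V - A", OF Diff_subset]
    using fE by (simp add: sum.If_cases Int_def)
  \<comment> \<open>Maximality of the degree of \<open>v\<close>: no neighbourhood is larger than
    \<open>A\<close>.\<close>
  also have "(\<Sum>x\<in>V - A. card (nbh E x)) \<le> (\<Sum>x\<in>V - A. card A)"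
    using mx unfolding A_def by (intro sum_mono) auto
  finally show ?thesis by (simp add: mult.commute)
qed

lemma card_mult_compl_le:
  assumes "finite V" "A \<subseteq> V"
  shows "real (card A) * real (card (V - A)) \<le> (card V)\<^sup>2 / 4"
proof -
  have "real (card V) = real (card A) + real (card (V - A))"
    using card_Diff_subset[OF finite_subset[OF assms(2,1)] assms(2)] card_mono[OF assms] by simp
  then show ?thesis
    using sum_squares_bound[of "real (card A)" "real (card (V - A))"]
    by (simp add: power2_eq_square algebra_simps)
qed

subsection \<open>Containers for triangle-free graphs\<close>

text \<open>The outputs of a container algorithm with at most \<open>k\<close> steps. An index
  sequence is the fingerprint of a container, so containers are counted by counting
  sequences.\<close>

fun reach :: "('i \<Rightarrow> 'c \<Rightarrow> 'c) \<Rightarrow> 'i set \<Rightarrow> nat \<Rightarrow> 'c set \<Rightarrow> 'c set" where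
  "reach opr I 0 S = S"
| "reach opr I (Suc k) S = reach opr I k S \<union> (\<lambda>(i, C). opr i C) ` (I \<times> reach opr I k S)"

lemma card_reach:
  assumes "finite I" "finite S"
  shows "finite (reach opr I k S) \<and> card (reach opr I k S) \<le> (1 + card I) ^ k * card S"
proof (induction k)
  case (Suc k)
  let ?R = "reach opr I k S"
  have "card (reach opr I (Suc k) S) \<le> card ?R + card ((\<lambda>(i, C). opr i C) ` (I \<times> ?R))"
    by (simp add: card_Un_le)
  also have "\<dots> \<le> card ?R + card (I \<times> ?R)"
    using Suc assms by (intro add_left_mono card_image_le) auto
  also have "\<dots> = (1 + card I) * card ?R"
    by (simp add: card_cartesian_product)
  also have "\<dots> \<le> (1 + card I) ^ Suc k * card S"
    using Suc mult_le_mono2[of "card ?R" "(1 + card I) ^ k * card S" "1 + card I"]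
    by (simp only: power_Suc mult.assoc)
  finally show ?case using Suc assms by auto
qed (use assms in auto)

text \<open>Potential argument: each operation on a bad \<open>C\<close> lowers \<open>f\<close> by
  \<open>\<delta>\<close>, and the initial value leaves no room for \<open>k\<close> such steps. The
  counter in \<open>P\<close> allows an invariant whose loss grows with the number of steps.\<close>

lemma reach_good:
  fixes f :: "'c \<Rightarrow> real"
  assumes "C0 \<in> S" "P 0 C0"
    and step: "\<And>j C. P j C \<Longrightarrow> \<not> good C \<Longrightarrow> \<exists>i\<in>I. P (Suc j) (opr i C) \<and> f (opr i C) + \<delta> \<le> f C"
    and nonneg: "\<And>C. f C \<ge> 0" and k: "f C0 < real k * \<delta>"
  shows "\<exists>j\<le>k. \<exists>C\<in>reach opr I k S. P j C \<and> good C"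
proof -
  \<comment> \<open>After \<open>m\<close> steps either a good object has been met or the potential
    has dropped \<open>m\<close> times.\<close>
  have "(\<exists>j\<le>m. \<exists>C\<in>reach opr I m S. P j C \<and> good C) \<or>
        (\<exists>C\<in>reach opr I m S. P m C \<and> f C + real m * \<delta> \<le> f C0)" for m
  proof (induction m)
    case 0
    then show ?case using assms(1,2) by auto
  next
    case (Suc m)
    show ?case
    proof (cases "\<exists>j\<le>m. \<exists>C\<in>reach opr I m S. P j C \<and> good C")
      case True
      then show ?thesis by (metis UnCI le_Suc_eq reach.simps(2))
    next
      case False
      then obtain C where C: "C \<in> reach opr I m S" "P m C" "f C + real m * \<delta> \<le> f C0" "\<not> good C"
        using Suc by auto
      obtain i where i: "i \<in> I" "P (Suc m) (opr i C)" "f (opr i C) + \<delta> \<le> f C"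
        using step[OF C(2,4)] by auto
      have "opr i C \<in> reach opr I (Suc m) S"
        using i(1) C(1) by force
      moreover have "f (opr i C) + real (Suc m) * \<delta> \<le> f C0"
        using i(3) C(3) by (simp add: algebra_simps)
      ultimately show ?thesis using i(2) by blast
    qed
  qed
  moreover have "f C0 < f C + real k * \<delta>" for C using k nonneg[of C] by linarith
  ultimately show ?thesis by (meson not_le)
qed

text \<open>First phase: a triangle-free \<open>H\<close> has no edge inside the neighbourhood
  \<open>N\<close> of a vertex, so deleting the pairs inside \<open>N\<close> costs nothing. While
  some such \<open>N\<close> spans many pairs of \<open>C\<close>, this removes a fixed proportion
  of all pairs. Hence a number of steps independent of \<open>card V\<close> suffices, although each
  step has \<open>2 ^ card V\<close> choices.\<close>

lemma containers_no_dense_link: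
  fixes V :: "'a set" and \<tau>' :: real
  assumes V: "finite V" "V \<noteq> {}" and a: "real a * \<tau>' > 1 / 2" and H: "H \<subseteq> nsets V 2" "tri_free H"
  shows "\<exists>C\<in>reach (\<lambda>N C. C - Pow N) (Pow V) a {nsets V 2}.
           H \<subseteq> C \<and> C \<subseteq> nsets V 2 \<and> (\<forall>v. real (card (C \<inter> Pow (nbh H v))) < \<tau>' * (card V)\<^sup>2)"
proof -
  let ?n = "card V"
  let ?P = "\<lambda>(j::nat) C. H \<subseteq> C \<and> C \<subseteq> nsets V 2"
  let ?good = "\<lambda>C. \<forall>v. real (card (C \<inter> Pow (nbh H v))) < \<tau>' * ?n\<^sup>2"
  have n: "?n > 0" using V by (simp add: card_gt_0_iff)
  have "\<exists>j\<le>a. \<exists>C\<in>reach (\<lambda>N C. C - Pow N) (Pow V) a {nsets V 2}. ?P j C \<and> ?good C"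
  proof (rule reach_good[where f = "\<lambda>C. real (card C)" and \<delta> = "\<tau>' * ?n\<^sup>2" and ?C0.0 = "nsets V 2"])
    fix j C assume P: "?P j C" and "\<not> ?good C"
    then obtain v where v: "\<tau>' * ?n\<^sup>2 \<le> real (card (C \<inter> Pow (nbh H v)))"
      by (auto simp: not_less)
    let ?N = "nbh H v"
    have fin: "finite C" using P V finite_edges by blast
    have "e \<notin> Pow ?N" if e: "e \<in> H" for e
    proof
      assume "e \<in> Pow ?N"
      moreover obtain x y where xy: "e = {x, y}" using edgeE[OF H(1) e] by blast
      ultimately have "{v, x} \<in> H" "{v, y} \<in> H" by (simp_all add: nbh_iff)
      then show False using e H(2) unfolding xy tri_free_def by metis
    qed
    then have "?P (Suc j) (C - Pow ?N)" using P by blast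
    moreover have "card (C - Pow ?N) + card (C \<inter> Pow ?N) = card C"
      using fin card_Diff_subset_Int[of C "Pow ?N"] card_mono[OF fin, of "C \<inter> Pow ?N"] by simp
    ultimately show "\<exists>N\<in>Pow V. ?P (Suc j) (C - Pow N) \<and> real (card (C - Pow N)) + \<tau>' * ?n\<^sup>2 \<le> real (card C)"
      using v nbh_subset[OF H(1), of v] by (intro bexI[of _ ?N]) auto
  next
    have "real (card (nsets V 2)) \<le> ?n\<^sup>2 * (1 / 2)" using card_nsets_le[OF V(1)] by simp
    also have "\<dots> < ?n\<^sup>2 * (real a * \<tau>')" using a n by (intro mult_strict_left_mono) auto
    finally show "real (card (nsets V 2)) < real a * (\<tau>' * ?n\<^sup>2)" by (simp add: mult_ac)
  qed (use H in auto)
  then show ?thesis by blast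
qed

text \<open>
  The set of neighbours to be disconnected from \<open>v\<close>: the vertices of high degree in the link of \<open>v\<close> if
  only few of them are neighbours in \<open>H\<close>, and otherwise the neighbourhood in the link of a suitable
  \<open>w\<close>. The first case is encoded by \<open>w = v\<close>, which cannot occur in the second.
\<close>

definition removal_set :: "real \<Rightarrow> 'a set set \<Rightarrow> 'a \<Rightarrow> 'a \<Rightarrow> 'a set" where
  "removal_set \<theta> C v w =
     (if w = v then {u \<in> nbh C v. real (card (nbh C u \<inter> nbh C v)) \<ge> \<theta>} else nbh C v \<inter> nbh C w)"

lemma removal_set_subset: "removal_set \<theta> C v w \<subseteq> nbh C v"
  by (auto simp: removal_set_def)

text \<open>Averaging over the dense link of \<open>v\<close> gives a set \<open>L\<close> of at
  least \<open>\<theta>\<close> vertices of link degree at least \<open>\<theta>\<close>. If few of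
  them are neighbours of \<open>v\<close> in \<open>H\<close>, then \<open>L\<close> can be removed.
  Otherwise many are, and as \<open>C\<close> is sparse inside \<open>nbh H v\<close>, one of these,
  \<open>w\<close>, has few neighbours in \<open>C\<close> there. So the common neighbours of
  \<open>v\<close> and \<open>w\<close> in \<open>C\<close> are numerous, but few of them lie in
  \<open>nbh H v\<close>.\<close>

lemma removal_set_exists:
  fixes V :: "'a set" and \<tau> \<mu> :: real
  assumes V: "finite V" "V \<noteq> {}" and \<tau>: "\<tau> > 0" and \<mu>: "\<mu> > 0"
    and C: "C \<subseteq> nsets V 2" and H: "H \<subseteq> nsets V 2"
    and dense: "real (card (C \<inter> Pow (nbh C v))) > \<tau> * (card V)\<^sup>2"
    and sparse: "real (card (C \<inter> Pow (nbh H v))) < \<mu>\<^sup>2 / 2 * (card V)\<^sup>2"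
    and v: "v \<in> V"
  defines "\<theta> \<equiv> \<tau> * card V / 2"
  shows "\<exists>w\<in>V. real (card (removal_set \<theta> C v w)) \<ge> \<theta> \<and>
                real (card (removal_set \<theta> C v w \<inter> nbh H v)) \<le> \<mu> * card V"
proof -
  let ?n = "real (card V)"
  define N where "N = nbh C v"
  define L where "L = {u \<in> N. real (card (nbh C u \<inter> N)) \<ge> \<theta>}"
  have n: "?n > 0" using V by (simp add: card_gt_0_iff)
  have fN: "finite N" "N \<subseteq> V" using finite_nbh[OF C V(1)] nbh_subset[OF C] by (auto simp: N_def)
  have NH: "finite (nbh H v)" "nbh H v \<subseteq> V" using finite_nbh[OF H V(1)] nbh_subset[OF H] by auto
  have LN: "L \<subseteq> N" "finite L" using fN by (auto simp: L_def)
  have cN: "real (card N) \<le> ?n" using fN V card_mono by auto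
  have cI: "real (card (nbh C u \<inter> N)) \<le> ?n" for u
    using card_mono[OF V(1), of "nbh C u \<inter> N"] fN by auto
  have "2 * \<tau> * ?n\<^sup>2 < real (2 * card (C \<inter> Pow N))"
    using dense by (simp add: N_def)
  also have "\<dots> = (\<Sum>u\<in>N. real (card (nbh C u \<inter> N)))"
    using handshake[OF C V(1) fN(2)] by (metis of_nat_sum)
  \<comment> \<open>Link degrees are at most \<open>?n\<close> on \<open>L\<close> and below
    \<open>\<theta>\<close> elsewhere.\<close>
  also have "\<dots> \<le> (\<Sum>u\<in>N. (if u \<in> L then ?n else 0) + \<theta>)"
    using cI \<tau> n by (intro sum_mono) (auto simp: L_def \<theta>_def intro: add_increasing2)
  also have "\<dots> = real (card L) * ?n + real (card N) * \<theta>"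
    using fN LN by (simp add: sum.distrib sum.If_cases Int_absorb1 flip: Int_def)
  also have "\<dots> \<le> real (card L) * ?n + ?n * \<theta>"
    using cN \<tau> n by (intro add_left_mono mult_right_mono) (auto simp: \<theta>_def)
  finally have "?n * (2 * \<tau> * ?n - \<theta>) < ?n * real (card L)"
    by (simp add: power2_eq_square algebra_simps)
  then have "2 * \<tau> * ?n - \<theta> < real (card L)" using n by simp
  then have cL: "\<theta> \<le> real (card L)" using \<tau> n by (auto simp: \<theta>_def)
  have Lr: "removal_set \<theta> C v v = L" by (simp add: removal_set_def L_def N_def)
  show ?thesis
  proof (cases "real (card (L \<inter> nbh H v)) \<le> \<mu> * ?n")
    case True
    then show ?thesis using Lr cL v by (intro bexI[of _ v]) auto
  next
    case False
    let ?W = "L \<inter> nbh H v"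
    \<comment> \<open>Otherwise the more than \<open>\<mu> * ?n\<close> vertices of
      \<open>?W\<close> alone make the degree sum inside \<open>nbh H v\<close> too large for
      \<open>sparse\<close>.\<close>
    have "\<exists>w\<in>?W. real (card (nbh C w \<inter> nbh H v)) \<le> \<mu> * ?n"
    proof (rule ccontr)
      assume "\<not> ?thesis"
      then have *: "real (card (nbh C w \<inter> nbh H v)) \<ge> \<mu> * ?n" if "w \<in> ?W" for w
        using that by (auto simp: not_le intro: less_imp_le)
      have "\<mu> * ?n * (\<mu> * ?n) < real (card ?W) * (\<mu> * ?n)"
        using False \<mu> n by (intro mult_strict_right_mono) auto
      also have "\<dots> = (\<Sum>w\<in>?W. \<mu> * ?n)" by simp
      also have "\<dots> \<le> (\<Sum>w\<in>?W. real (card (nbh C w \<inter> nbh H v)))"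
        using * by (intro sum_mono)
      also have "\<dots> \<le> (\<Sum>w\<in>nbh H v. real (card (nbh C w \<inter> nbh H v)))"
        using NH by (intro sum_mono2) auto
      also have "\<dots> = real (2 * card (C \<inter> Pow (nbh H v)))"
        using handshake[OF C V(1) NH(2)] by (metis of_nat_sum)
      also have "\<dots> < 2 * (\<mu>\<^sup>2 / 2 * ?n\<^sup>2)" using sparse by simp
      finally show False by (simp add: power2_eq_square algebra_simps)
    qed
    then obtain w where w: "w \<in> L" "w \<in> nbh H v" "real (card (nbh C w \<inter> nbh H v)) \<le> \<mu> * ?n"
      by auto
    have wv: "w \<noteq> v" "w \<in> V" using w(1) LN nbh_subset[OF C, of v] fN by (auto simp: N_def)
    have r: "removal_set \<theta> C v w = nbh C v \<inter> nbh C w" using wv by (simp add: removal_set_def)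
    have "real (card (nbh C v \<inter> nbh C w)) \<ge> \<theta>"
      using w(1) by (simp add: L_def N_def Int_commute)
    moreover have "card (nbh C v \<inter> nbh C w \<inter> nbh H v) \<le> card (nbh C w \<inter> nbh H v)"
      using NH by (intro card_mono) auto
    ultimately show ?thesis using r w(3) wv by (intro bexI[of _ w]) auto
  qed
qed

text \<open>Second phase: deleting the edges from \<open>v\<close> to its removal set shrinks
  \<open>C\<close> by at least \<open>\<tau> * card V / 2\<close> edges, of which at most
  \<open>\<mu> * card V\<close> belong to \<open>H\<close>. Now order \<open>card V / \<tau>\<close>
  steps are needed, but each has only \<open>(card V)\<^sup>2\<close> choices. Sparsity inside the
  neighbourhoods of \<open>H\<close> survives the deletions.\<close>

lemma containers_sparse_neighbourhoods:
  fixes V :: "'a set" and \<tau> \<mu> :: real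
  assumes V: "finite V" "V \<noteq> {}" and \<tau>: "\<tau> > 0" and \<mu>: "\<mu> > 0" and k: "real k * \<tau> > card V"
    and H: "H \<subseteq> nsets V 2"
    and C0: "C0 \<in> S" "H \<subseteq> C0" "C0 \<subseteq> nsets V 2"
    and sparse: "\<And>v. real (card (C0 \<inter> Pow (nbh H v))) < \<mu>\<^sup>2 / 2 * (card V)\<^sup>2"
  shows "\<exists>C\<in>reach (\<lambda>(v, w) C. C - (\<lambda>u. {v, u}) ` removal_set (\<tau> * card V / 2) C v w) (V \<times> V) k S.
           C \<subseteq> nsets V 2 \<and> real (card (H - C)) \<le> real k * (\<mu> * card V) \<and>
           (\<forall>v\<in>V. real (card (C \<inter> Pow (nbh C v))) \<le> \<tau> * (card V)\<^sup>2)"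
proof -
  let ?n = "card V"
  let ?\<theta> = "\<tau> * ?n / 2"
  let ?P = "\<lambda>(j::nat) C. C \<subseteq> C0 \<and> real (card (H - C)) \<le> real j * (\<mu> * ?n)"
  let ?good = "\<lambda>C. \<forall>v\<in>V. real (card (C \<inter> Pow (nbh C v))) \<le> \<tau> * ?n\<^sup>2"
  let ?op = "\<lambda>(v, w) C. C - (\<lambda>u. {v, u}) ` removal_set ?\<theta> C v w"
  have n: "?n > 0" using V by (simp add: card_gt_0_iff)
  have fH: "finite H" "finite C0" using finite_edges V H C0 by auto
  have "\<exists>j\<le>k. \<exists>C\<in>reach ?op (V \<times> V) k S. ?P j C \<and> ?good C"
  proof (rule reach_good[where f = "\<lambda>C. real (card C)" and \<delta> = ?\<theta> and ?C0.0 = C0])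
    fix j C assume P: "?P j C" and "\<not> ?good C"
    then obtain v where v: "v \<in> V" "\<tau> * ?n\<^sup>2 < real (card (C \<inter> Pow (nbh C v)))"
      by (auto simp: not_le)
    have C: "C \<subseteq> nsets V 2" "finite C" using P C0 fH finite_subset by auto
    have "card (C \<inter> Pow (nbh H v)) \<le> card (C0 \<inter> Pow (nbh H v))"
      using P fH by (intro card_mono) auto
    then have "real (card (C \<inter> Pow (nbh H v))) < \<mu>\<^sup>2 / 2 * ?n\<^sup>2"
      using sparse[of v] by simp
    from removal_set_exists[OF V \<tau> \<mu> C(1) H v(2) this v(1)]
    obtain w where w: "w \<in> V" "real (card (removal_set ?\<theta> C v w)) \<ge> ?\<theta>"
      "real (card (removal_set ?\<theta> C v w \<inter> nbh H v)) \<le> \<mu> * ?n" by auto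
    let ?R = "removal_set ?\<theta> C v w"
    let ?E = "(\<lambda>u. {v, u}) ` ?R"
    have R: "?R \<subseteq> nbh C v" by (rule removal_set_subset)
    have fR: "finite ?R" using R finite_nbh[OF C(1) V(1)] finite_subset by blast
    have inj: "inj_on (\<lambda>u. {v, u}) A" for A by (auto simp: inj_on_def doubleton_eq_iff)
    have EC: "?E \<subseteq> C" using R by (auto simp: nbh_iff)
    have "card (C - ?E) + card ?R = card C"
      using card_Diff_subset[OF finite_imageI[OF fR] EC] card_mono[OF C(2) EC] card_image[OF inj[of ?R]]
      by simp
    then have f: "real (card (C - ?E)) + ?\<theta> \<le> real (card C)" using w(2) by linarith
    have "H - (C - ?E) \<subseteq> (H - C) \<union> (\<lambda>u. {v, u}) ` (?R \<inter> nbh H v)"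
      by (auto simp: nbh_iff)
    then have "card (H - (C - ?E)) \<le> card ((H - C) \<union> (\<lambda>u. {v, u}) ` (?R \<inter> nbh H v))"
      using fH fR by (intro card_mono) auto
    also have "\<dots> \<le> card (H - C) + card ((\<lambda>u. {v, u}) ` (?R \<inter> nbh H v))"
      by (rule card_Un_le)
    also have "card ((\<lambda>u. {v, u}) ` (?R \<inter> nbh H v)) = card (?R \<inter> nbh H v)"
      by (rule card_image[OF inj])
    finally have "?P (Suc j) (C - ?E)"
      using P w(3) by (auto simp: algebra_simps)
    then show "\<exists>i\<in>V \<times> V. ?P (Suc j) (?op i C) \<and> real (card (?op i C)) + ?\<theta> \<le> real (card C)"
      using f w(1) v(1) by (intro bexI[of _ "(v, w)"]) auto
  next
    have "real (card C0) \<le> ?n\<^sup>2 / 2"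
      using card_nsets_le[OF V(1)] card_mono[OF finite_imp_finite_nsets[OF V(1)] C0(3)]
      by linarith
    also have "\<dots> = ?n * real ?n / 2" by (simp add: power2_eq_square)
    also have "\<dots> < (real k * \<tau>) * real ?n / 2"
      using k n by (intro divide_strict_right_mono mult_strict_right_mono) auto
    finally show "real (card C0) < real k * ?\<theta>" by (simp add: mult_ac)
  qed (use C0 in \<open>auto simp: Diff_eq_empty_iff[THEN iffD2]\<close>)
  then obtain j C where *: "j \<le> k" "C \<in> reach ?op (V \<times> V) k S" "?P j C" "?good C" by blast
  have "real (card (H - C)) \<le> real j * (\<mu> * ?n)" using *(3) by simp
  also have "\<dots> \<le> real k * (\<mu> * ?n)"
    using *(1) \<mu> by (intro mult_right_mono) auto
  finally show ?thesis using * C0 by blast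
qed

text \<open>The two phases in succession. With \<open>a\<close> constant and \<open>k\<close> of
  order \<open>card V\<close>, the logarithm of the number of containers has order
  \<open>card V * ln (card V)\<close>, which a union bound against failure probabilities
  exponentially small in \<open>(card V)\<^sup>2\<close> can afford.\<close>

lemma containers:
  fixes V :: "'a set" and \<tau> \<mu> :: real
  assumes V: "finite V" "V \<noteq> {}" and \<tau>: "\<tau> > 0" and \<mu>: "\<mu> > 0"
    and a: "real a * \<mu>\<^sup>2 > 1" and k: "real k * \<tau> > card V"
  obtains \<F> where "finite \<F>" "card \<F> \<le> (1 + (card V)\<^sup>2) ^ k * (1 + 2 ^ card V) ^ a"
    "\<And>C. C \<in> \<F> \<Longrightarrow> C \<subseteq> nsets V 2"
    "\<And>H. H \<subseteq> nsets V 2 \<Longrightarrow> tri_free H \<Longrightarrow>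
       \<exists>C\<in>\<F>. real (card (H - C)) \<le> real k * (\<mu> * card V) \<and>
         (\<forall>v\<in>V. real (card (C \<inter> Pow (nbh C v))) \<le> \<tau> * (card V)\<^sup>2)"
proof -
  let ?S = "reach (\<lambda>N C. C - Pow N) (Pow V) a {nsets V 2}"
  let ?F = "reach (\<lambda>(v, w) C. C - (\<lambda>u. {v, u}) ` removal_set (\<tau> * card V / 2) C v w) (V \<times> V) k ?S"
  have S: "finite ?S" "card ?S \<le> (1 + 2 ^ card V) ^ a"
    using card_reach[of "Pow V" "{nsets V 2}" _ a] V by (auto simp: card_Pow)
  have F: "finite ?F" "card ?F \<le> (1 + (card V)\<^sup>2) ^ k * card ?S"
    using card_reach[of "V \<times> V" ?S _ k] V S by (auto simp: card_cartesian_product power2_eq_square)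
  show ?thesis
  proof (rule that[of "?F \<inter> Pow (nsets V 2)"])
    have "card (?F \<inter> Pow (nsets V 2)) \<le> card ?F" using F by (intro card_mono) auto
    also have "\<dots> \<le> (1 + (card V)\<^sup>2) ^ k * (1 + 2 ^ card V) ^ a"
      using F(2) S(2) by (meson le_trans mult_le_mono2)
    finally show "card (?F \<inter> Pow (nsets V 2)) \<le> (1 + (card V)\<^sup>2) ^ k * (1 + 2 ^ card V) ^ a" .
  next
    fix H assume H: "H \<subseteq> nsets V 2" "tri_free H"
    have "real a * (\<mu>\<^sup>2 / 2) > 1 / 2" using a by simp
    from containers_no_dense_link[OF V this H]
    obtain C0 where C0: "C0 \<in> ?S" "H \<subseteq> C0" "C0 \<subseteq> nsets V 2"
      "\<And>v. real (card (C0 \<inter> Pow (nbh H v))) < \<mu>\<^sup>2 / 2 * (card V)\<^sup>2" by blast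
    from containers_sparse_neighbourhoods[OF V \<tau> \<mu> k H(1) C0]
    show "\<exists>C\<in>?F \<inter> Pow (nsets V 2). real (card (H - C)) \<le> real k * (\<mu> * card V) \<and>
         (\<forall>v\<in>V. real (card (C \<inter> Pow (nbh C v))) \<le> \<tau> * (card V)\<^sup>2)"
      by blast
  qed (use F in auto)
qed

subsection \<open>Maximum triangle-free subgraphs of a typical graph\<close>

definition between :: "'a set set \<Rightarrow> 'a set \<Rightarrow> 'a set \<Rightarrow> 'a set set" where
  "between E S T = {e \<in> E. \<exists>x\<in>S. \<exists>y\<in>T. e = {x, y}}"

text \<open>Both sides count all edges at \<open>x\<close> together with the edges avoiding
  \<open>x\<close> that cross \<open>A\<close>.\<close>

lemma card_cut_move:
  assumes H: "H \<subseteq> nsets V 2" "finite V" and x: "x \<in> A"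
  shows "card (cut H A) + card (nbh H x \<inter> A) = card (cut H (A - {x})) + card (nbh H x - A)"
proof -
  let ?f = "\<lambda>y. {x, y}"
  have inj: "inj_on ?f B" for B by (auto simp: inj_on_def doubleton_eq_iff)
  have fin: "finite (cut H B)" for B
    using finite_edges[OF H] cut_subset finite_subset by metis
  have fN: "finite (nbh H x)" using finite_nbh H by metis
  have xx: "x \<notin> nbh H x" using nbh_subset[OF H(1)] by blast
  have "e \<in> cut H A \<union> ?f ` (nbh H x \<inter> A) \<longleftrightarrow> e \<in> cut H (A - {x}) \<union> ?f ` (nbh H x - A)" for e
  proof (cases "e \<in> H")
    case True
    then obtain a b where ab: "e = {a, b}" "a \<noteq> b" using edgeE[OF H(1)] by blast
    show ?thesis
    proof (cases "x \<in> e")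
      case True
      then obtain y where y: "e = {x, y}" "x \<noteq> y" using ab by auto
      then have "y \<in> nbh H x" using \<open>e \<in> H\<close> by (simp add: nbh_iff)
      then show ?thesis
        using x y \<open>e \<in> H\<close> by (auto simp: doubleton_in_cut)
    next
      case False
      then have "e \<notin> ?f ` B" for B by auto
      moreover have "e \<in> cut H A \<longleftrightarrow> e \<in> cut H (A - {x})" using False by (auto simp: cut_def)
      ultimately show ?thesis by blast
    qed
  next
    case False
    then show ?thesis by (auto simp: cut_def nbh_iff)
  qed
  then have eq: "cut H A \<union> ?f ` (nbh H x \<inter> A) = cut H (A - {x}) \<union> ?f ` (nbh H x - A)" by blast
  have dis: "cut H A \<inter> ?f ` (nbh H x \<inter> A) = {}" "cut H (A - {x}) \<inter> ?f ` (nbh H x - A) = {}"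
    using x xx by (auto simp: doubleton_in_cut)
  have "card (cut H A \<union> ?f ` (nbh H x \<inter> A)) = card (cut H A) + card (nbh H x \<inter> A)"
    "card (cut H (A - {x}) \<union> ?f ` (nbh H x - A)) = card (cut H (A - {x})) + card (nbh H x - A)"
    by (simp_all only: card_Un_disjoint[OF fin finite_imageI dis(1)] card_Un_disjoint[OF fin finite_imageI dis(2)]
        card_image[OF inj] fN finite_Int finite_Diff simp_thms)
  then show ?thesis using eq by simp
qed

text \<open>An edge missing every vertex of a maximal \<open>M\<close> could be added to
  \<open>M\<close>, so these vertices cover \<open>F\<close>.\<close>

lemma maximal_matching_exists:
  assumes "finite F"
  shows "\<exists>M\<subseteq>F. pairwise disjnt M \<and> (\<forall>e\<in>F. e \<noteq> {} \<longrightarrow> e \<inter> \<Union>M \<noteq> {})"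
proof -
  let ?S = "{M. M \<subseteq> F \<and> pairwise disjnt M}"
  have fin: "finite ?S" using assms by simp
  have "?S \<noteq> {}" by (auto intro!: exI[of _ "{}"] simp: pairwise_empty)
  from finite_has_maximal[OF fin this]
  obtain M where M0: "M \<in> ?S" "\<forall>M'\<in>?S. M \<subseteq> M' \<longrightarrow> M = M'" by (rule bexE)
  have M: "M \<in> ?S" "\<And>M'. M' \<in> ?S \<Longrightarrow> M \<subseteq> M' \<Longrightarrow> M = M'" using M0 by simp_all
  have "e \<inter> \<Union>M \<noteq> {}" if e: "e \<in> F" "e \<noteq> {}" for e
  proof
    assume dis: "e \<inter> \<Union>M = {}"
    then have "insert e M \<in> ?S" using M(1) e by (auto simp: pairwise_insert disjnt_def)
    then have "e \<in> M" using M(2)[of "insert e M"] by auto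
    then show False using dis e by auto
  qed
  then show ?thesis using M(1) by blast
qed

lemma card_le_cover:
  assumes F: "F \<subseteq> nsets V 2" "finite V" and Q: "finite Q" "\<And>e. e \<in> F \<Longrightarrow> e \<inter> Q \<noteq> {}"
    and t: "\<And>x. x \<in> Q \<Longrightarrow> card (nbh F x) \<le> t"
  shows "card F \<le> card Q * t"
proof -
  have "F \<subseteq> (\<Union>x\<in>Q. {e \<in> F. x \<in> e})" using Q by blast
  then have "card F \<le> card (\<Union>x\<in>Q. {e \<in> F. x \<in> e})"
    using finite_edges[OF F] Q by (intro card_mono) auto
  also have "\<dots> \<le> (\<Sum>x\<in>Q. card {e \<in> F. x \<in> e})" using Q(1) by (rule card_UN_le)
  also have "\<dots> \<le> (\<Sum>x\<in>Q. t)" using t card_nbh_edges[OF F(1)] by (intro sum_mono) metis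
  finally show ?thesis by simp
qed

lemma ex_max_on:
  fixes f :: "'b \<Rightarrow> nat"
  assumes "finite A" "A \<noteq> {}"
  shows "\<exists>x\<in>A. \<forall>y\<in>A. f y \<le> f x"
proof -
  from obtains_MAX[OF assms, of f] obtain x where x: "x \<in> A" "Max (f ` A) = f x" by blast
  have "f y \<le> f x" if "y \<in> A" for y
    using that x(2) assms(1) by (metis Max_ge finite_imageI imageI)
  then show ?thesis using x(1) by blast
qed

text \<open>The interface between the deterministic and the probabilistic half. \<open>q\<close> is
  the lower bound for the density \<open>p\<close>, \<open>\<tau>\<close> the relative error of edge
  counts, and \<open>t0\<close> and \<open>k0\<close> are the sizes from which pairs of sets and
  matchings behave as expected. \<open>\<zeta>\<close> is both the threshold for too few common
  neighbours across a cut and the gain of a better cut. \<open>par\<close> says how these scales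
  compare.\<close>

locale typical_graph =
  fixes V :: "'a set" and E :: "'a set set" and p q \<tau> k0 t0 \<zeta> :: real
  assumes V: "finite V" "V \<noteq> {}" and E: "E \<subseteq> nsets V 2"
    and pq: "0 < q" "q \<le> p" "p \<le> 1" and pos: "\<tau> > 0" "k0 > 0" "t0 > 0"
    and cut_upper: "\<And>A. A \<subseteq> V \<Longrightarrow>
      real (card (cut E A)) \<le> p * (real (card A) * real (card (V - A))) + \<tau> * (real (card V))\<^sup>2"
    and cut_lower: "\<exists>A\<subseteq>V. real (card (cut E A)) \<ge> p * (real (card V))\<^sup>2 / 4 - 2 * \<tau> * (real (card V))\<^sup>2"
    and container: "\<And>H. H \<subseteq> E \<Longrightarrow> tri_free H \<Longrightarrow> \<exists>C. C \<subseteq> nsets V 2 \<and>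
      real (card (H - C)) \<le> 2 * \<tau> * (real (card V))\<^sup>2 \<and>
      (\<forall>v\<in>V. real (card (C \<inter> Pow (nbh C v))) \<le> \<tau> * (real (card V))\<^sup>2) \<and>
      real (card (E \<inter> C)) \<le> p * card C + \<tau> * (real (card V))\<^sup>2"
    and dense_pairs: "\<And>S T. S \<subseteq> V \<Longrightarrow> T \<subseteq> V \<Longrightarrow> S \<inter> T = {} \<Longrightarrow> card S = card T \<Longrightarrow> real (card S) \<ge> t0 \<Longrightarrow>
      real (card (between E S T)) \<ge> q / 2 * (real (card S))\<^sup>2"
    and matching: "\<And>A M. A \<subseteq> V \<Longrightarrow> real (card (V - A)) \<ge> card V / 5 \<Longrightarrow> M \<subseteq> nsets A 2 \<Longrightarrow>
      pairwise disjnt M \<Longrightarrow> real (card M) \<ge> k0 \<Longrightarrow>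
      real (card {(e, z). e \<in> M \<and> z \<in> V - A \<and> (\<forall>x\<in>e. {x, z} \<in> E)}) \<ge> q\<^sup>2 / 20 * card M * card V"
    and defect: "\<And>A x y. A \<subseteq> V \<Longrightarrow> x \<in> A \<Longrightarrow> y \<in> A \<Longrightarrow> x \<noteq> y \<Longrightarrow>
      real (card (nbh E x \<inter> nbh E y - A)) < \<zeta> \<Longrightarrow>
      \<exists>X\<subseteq>V. real (card (cut E X)) \<ge> real (card (cut E A)) + \<zeta>"
    and par: "12 * \<tau> / q < q / 2 * (q\<^sup>2 / 320)\<^sup>2" "t0 \<le> q\<^sup>2 / 320 * card V"
      "q * t0 \<ge> 32 * k0" "6 * k0 * t0 < \<zeta>"
begin

abbreviation n :: real where "n \<equiv> real (card V)"

lemma n_pos: "n > 0" using V by (simp add: card_gt_0_iff)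

lemma finite_E: "finite E" using finite_edges[OF E V(1)] .

text \<open>\<open>H\<close> has almost as many edges as a balanced cut, and nearly all of them lie
  in \<open>E \<inter> C\<close>, whose size is at most about \<open>p * card C\<close>. So
  \<open>C\<close> has nearly \<open>n\<^sup>2 / 4\<close> edges or more. As few of them lie inside
  the largest neighbourhood \<open>A\<close>, \<open>edge_count_stability\<close> leaves few inside
  \<open>V - A\<close> as well.\<close>

lemma near_bipartite:
  assumes H: "H \<subseteq> E" "tri_free H" and big: "real (card H) \<ge> p * n\<^sup>2 / 4 - 2 * \<tau> * n\<^sup>2"
  obtains A where "A \<subseteq> V" "real (card (H - cut H A)) \<le> 9 * \<tau> / q * n\<^sup>2"
proof -
  from container[OF H] obtain C where "C \<subseteq> nsets V 2 \<and> real (card (H - C)) \<le> 2 * \<tau> * n\<^sup>2 \<and>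
      (\<forall>v\<in>V. real (card (C \<inter> Pow (nbh C v))) \<le> \<tau> * n\<^sup>2) \<and>
      real (card (E \<inter> C)) \<le> p * card C + \<tau> * n\<^sup>2" by (rule exE)
  then have C: "C \<subseteq> nsets V 2" "real (card (H - C)) \<le> 2 * \<tau> * n\<^sup>2"
    "\<And>v. v \<in> V \<Longrightarrow> real (card (C \<inter> Pow (nbh C v))) \<le> \<tau> * n\<^sup>2"
    "real (card (E \<inter> C)) \<le> p * card C + \<tau> * n\<^sup>2" by simp_all
  have fin: "finite C" "finite H" using finite_edges[OF C(1) V(1)] finite_subset[OF H(1) finite_E] .
  obtain v where v: "v \<in> V" "\<And>w. w \<in> V \<Longrightarrow> card (nbh C w) \<le> card (nbh C v)"
    using ex_max_on[OF V, of "\<lambda>w. card (nbh C w)"] by blast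
  define A where "A = nbh C v"
  have A: "A \<subseteq> V" using nbh_subset[OF C(1)] by (auto simp: A_def)
  have st: "real (card C) + real (card (C \<inter> Pow (V - A))) \<le> real (card (C \<inter> Pow A)) + real (card A) * real (card (V - A))"
    using edge_count_stability[OF C(1) V(1) v] unfolding A_def of_nat_add[symmetric] of_nat_mult[symmetric] of_nat_le_iff .
  have cm: "real (card A) * real (card (V - A)) \<le> n\<^sup>2 / 4"
    using card_mult_compl_le[OF V(1) A] by simp
  have sub: "H - cut H A \<subseteq> (H - C) \<union> (C \<inter> Pow A \<union> C \<inter> Pow (V - A))"
    using H(1) E by (auto simp: cut_def nsets_def)
  have "card (H - cut H A) \<le> card ((H - C) \<union> (C \<inter> Pow A \<union> C \<inter> Pow (V - A)))"
    using fin by (intro card_mono sub) auto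
  also have "\<dots> \<le> card (H - C) + (card (C \<inter> Pow A) + card (C \<inter> Pow (V - A)))"
    by (meson add_left_mono card_Un_le le_trans)
  finally have 1: "real (card (H - cut H A)) \<le> 2 * \<tau> * n\<^sup>2 + \<tau> * n\<^sup>2 + real (card (C \<inter> Pow (V - A)))"
    using C(2) C(3)[OF v(1)] unfolding A_def by linarith
  have "card H \<le> card (H - C) + card (H \<inter> C)"
    by (metis Int_Diff_Un Un_commute card_Un_le)
  moreover have "card (H \<inter> C) \<le> card (E \<inter> C)"
    using H(1) finite_E by (intro card_mono) auto
  ultimately have "p * n\<^sup>2 / 4 - 5 * \<tau> * n\<^sup>2 \<le> p * card C"
    using C(2,4) big by linarith
  then have "p * (n\<^sup>2 / 4 - 5 * \<tau> * n\<^sup>2 / p) \<le> p * card C"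
    using pq by (simp add: right_diff_distrib mult.assoc)
  then have "n\<^sup>2 / 4 - 5 * \<tau> * n\<^sup>2 / p \<le> card C"
    using pq by (simp add: mult_le_cancel_left_pos)
  then have "real (card (C \<inter> Pow (V - A))) \<le> \<tau> * n\<^sup>2 + 5 * \<tau> * n\<^sup>2 / p"
    using st cm C(3)[OF v(1)] unfolding A_def by linarith
  then have "real (card (H - cut H A)) \<le> (4 * \<tau> + 5 * \<tau> / p) * n\<^sup>2"
    using 1 by (simp add: algebra_simps)
  also have "\<dots> \<le> (9 * \<tau> / q) * n\<^sup>2"
  proof (rule mult_right_mono)
    have "5 * \<tau> / p \<le> 5 * \<tau> / q" using pq pos by (intro divide_left_mono) auto
    moreover have "4 * \<tau> \<le> 4 * \<tau> / q" using pq pos by (simp add: field_simps)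
    ultimately show "4 * \<tau> + 5 * \<tau> / p \<le> 9 * \<tau> / q" by simp
  qed simp
  finally show ?thesis using that A by blast
qed

text \<open>Since moving \<open>x\<close> does not improve the cut, \<open>x\<close> has at least as
  many neighbours in \<open>H\<close> across as on its own side. An edge of \<open>E\<close> between
  these two neighbourhoods would close a triangle in \<open>H\<close>, so all of them are missing,
  and there are many.\<close>

lemma inner_degree_bound:
  assumes H: "H \<subseteq> E" "tri_free H" and A: "A \<subseteq> V"
    and mx: "\<And>X. X \<subseteq> V \<Longrightarrow> card (cut H X) \<le> card (cut H A)"
    and x: "x \<in> A" and t: "real (card (nbh H x \<inter> A)) \<ge> t0"
  shows "real (card (cut E A - H)) \<ge> q / 2 * (real (card (nbh H x \<inter> A)))\<^sup>2"
proof -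
  have HV: "H \<subseteq> nsets V 2" using H E by auto
  have "card (nbh H x \<inter> A) \<le> card (nbh H x - A)"
    using card_cut_move[OF HV V(1) x] mx[of "A - {x}"] A by fastforce
  \<comment> \<open>Shrunk because \<open>dense_pairs\<close> is about sets of equal size.\<close>
  then obtain U where U: "U \<subseteq> nbh H x - A" "card U = card (nbh H x \<inter> A)"
    by (metis obtain_subset_with_card_n)
  have "between E (nbh H x \<inter> A) U \<subseteq> cut E A - H"
  proof
    fix e assume "e \<in> between E (nbh H x \<inter> A) U"
    then obtain y z where yz: "e = {y, z}" "y \<in> nbh H x \<inter> A" "z \<in> nbh H x - A" "e \<in> E"
      using U by (auto simp: between_def)
    then have "e \<notin> H" using H(2) unfolding tri_free_def by (auto simp: nbh_iff)
    then show "e \<in> cut E A - H" using yz by (simp add: doubleton_in_cut)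
  qed
  then have "card (between E (nbh H x \<inter> A) U) \<le> card (cut E A - H)"
    using finite_subset[OF cut_subset finite_E] by (intro card_mono) auto
  moreover have "q / 2 * (real (card (nbh H x \<inter> A)))\<^sup>2 \<le> real (card (between E (nbh H x \<inter> A) U))"
    using U A t nbh_subset[OF HV, of x] by (intro dense_pairs) auto
  ultimately show ?thesis by linarith
qed

text \<open>A common neighbour \<open>z\<close> of the ends of an edge of \<open>M\<close> forces
  one of the two edges at \<open>z\<close> to be missing from \<open>H\<close>. That edge determines
  \<open>z\<close> as its end outside \<open>A\<close>, and its other end determines the edge of
  \<open>M\<close>, as \<open>M\<close> is a matching. So distinct pairs yield distinct missing
  edges.\<close>

lemma matching_bound:
  assumes H: "H \<subseteq> E" "tri_free H" and A: "A \<subseteq> V" "real (card (V - A)) \<ge> n / 5"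
    and M: "M \<subseteq> H \<inter> Pow A" "pairwise disjnt M" "real (card M) \<ge> k0"
  shows "real (card (cut E A - H)) \<ge> q\<^sup>2 / 20 * card M * n"
proof -
  let ?P = "{(e, z). e \<in> M \<and> z \<in> V - A \<and> (\<forall>x\<in>e. {x, z} \<in> E)}"
  have MA: "M \<subseteq> nsets A 2" using M(1) H(1) E by (auto simp: nsets_def)
  have "\<exists>x\<in>e. {x, z} \<notin> H" if "(e, z) \<in> ?P" for e z
  proof -
    have e: "e \<in> H" using that M(1) by auto
    have "card e = 2" using that MA by (auto simp: nsets_def)
    then obtain x y where xy: "e = {x, y}" by (auto simp: card_2_iff)
    show ?thesis
    proof (rule ccontr)
      assume "\<not> ?thesis"
      then have "{x, z} \<in> H" "{y, z} \<in> H" "{x, y} \<in> H" using xy e by auto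
      then show False using H(2) unfolding tri_free_def by blast
    qed
  qed
  then have "\<forall>ez\<in>?P. \<exists>x. x \<in> fst ez \<and> {x, snd ez} \<notin> H" by fastforce
  from bchoice[OF this] obtain g where "\<forall>ez\<in>?P. g ez \<in> fst ez \<and> {g ez, snd ez} \<notin> H"
    by (rule exE)
  then have g: "g ez \<in> fst ez \<and> {g ez, snd ez} \<notin> H" if "ez \<in> ?P" for ez
    using that by (rule bspec)
  have gA: "g ez \<in> A" "snd ez \<notin> A" "fst ez \<in> M" if "ez \<in> ?P" for ez
  proof -
    show 1: "fst ez \<in> M" "snd ez \<notin> A" using that by auto
    then have "fst ez \<subseteq> A" using M(1) by blast
    then show "g ez \<in> A" using g[OF that] by blast
  qed
  let ?f = "\<lambda>ez. {g ez, snd ez}"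
  have "inj_on ?f ?P"
  proof (rule inj_onI)
    fix a b assume ab: "a \<in> ?P" "b \<in> ?P" "?f a = ?f b"
    then have s: "snd a = snd b" "g a = g b" using gA by (auto simp: doubleton_eq_iff)
    then have "g a \<in> fst a \<inter> fst b" using g[OF ab(1)] g[OF ab(2)] by auto
    then have "fst a = fst b" using M(2) gA(3)[OF ab(1)] gA(3)[OF ab(2)]
      by (auto simp: pairwise_def disjnt_def)
    then show "a = b" using s by (simp add: prod_eq_iff)
  qed
  moreover have "?f ` ?P \<subseteq> cut E A - H"
  proof (rule image_subsetI)
    fix ez assume ez: "ez \<in> ?P"
    have "{g ez, snd ez} \<in> E" using g[OF ez] ez by auto
    then show "?f ez \<in> cut E A - H" using g[OF ez] gA[OF ez] by (simp add: doubleton_in_cut)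
  qed
  moreover have "finite (cut E A - H)" using finite_subset[OF cut_subset finite_E] by simp
  ultimately have "card ?P \<le> card (cut E A - H)" by (rule card_inj_on_le)
  then show ?thesis using matching[OF A MA M(2,3)] by linarith
qed

text \<open>A maximal matching \<open>M\<close> and the maximum inner degree \<open>t\<close> allow
  at most \<open>2 * card M * t\<close> inner edges. If \<open>M\<close> is large,
  \<open>matching_bound\<close> pays for them as long as \<open>t \<le> D\<close>, and a larger
  \<open>t\<close> would contradict \<open>few\<close> by \<open>inner_degree_bound\<close>. If
  \<open>M\<close> is small, \<open>inner_degree_bound\<close> pays for a large \<open>t\<close>,
  and a small \<open>t\<close> leaves at most \<open>2 * k0 * t0\<close> inner edges.\<close>

lemma inner_edges_bound:
  assumes H: "H \<subseteq> E" "tri_free H" and A: "A \<subseteq> V" "real (card (V - A)) \<ge> n / 5"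
    and mx: "\<And>X. X \<subseteq> V \<Longrightarrow> card (cut H X) \<le> card (cut H A)"
    and few: "real (card (cut E A - H)) \<le> 12 * \<tau> / q * n\<^sup>2"
  shows "8 * real (card (H \<inter> Pow A)) \<le> real (card (cut E A - H)) + 16 * k0 * t0"
proof -
  define F where "F = H \<inter> Pow A"
  \<comment> \<open>Chosen so that \<open>16 * D\<close> is \<open>q\<^sup>2 / 20 * n\<close>, the
    number of missing edges that \<open>matching_bound\<close> gives per edge of
    \<open>M\<close>.\<close>
  define D where "D = q\<^sup>2 / 320 * n"
  have F: "F \<subseteq> nsets V 2" using H E by (auto simp: F_def)
  from maximal_matching_exists[OF finite_edges[OF F V(1)]]
  obtain M where "M \<subseteq> F \<and> pairwise disjnt M \<and> (\<forall>e\<in>F. e \<noteq> {} \<longrightarrow> e \<inter> \<Union>M \<noteq> {})"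
    by (elim exE)
  then have M: "M \<subseteq> F" "pairwise disjnt M" "\<And>e. e \<in> F \<Longrightarrow> e \<noteq> {} \<Longrightarrow> e \<inter> \<Union>M \<noteq> {}"
    by simp_all
  have fM: "finite M" using M(1) finite_edges[OF F V(1)] finite_subset by blast
  have M2: "card e = 2" "finite e" "e \<subseteq> A" if "e \<in> M" for e
    using that M(1) F by (auto simp: F_def nsets_def)
  define t where "t = Max (insert 0 ((\<lambda>x. card (nbh H x \<inter> A)) ` A))"
  have fA: "finite A" using A V finite_subset by blast
  have t_ge: "card (nbh H x \<inter> A) \<le> t" if "x \<in> A" for x
    using that fA by (auto simp: t_def intro: Max_ge)
  \<comment> \<open>The \<open>0\<close> caters for an empty \<open>A\<close>. In \<open>tq\<close>
    it is excluded by \<open>t0 > 0\<close>, so there \<open>t\<close> is the inner degree of some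
    vertex.\<close>
  have "t \<in> insert 0 ((\<lambda>x. card (nbh H x \<inter> A)) ` A)"
    unfolding t_def using fA by (intro Max_in) auto
  then have tq: "real (card (cut E A - H)) \<ge> q / 2 * (real t)\<^sup>2" if "real t \<ge> t0"
    using inner_degree_bound[OF H A(1) mx] that pos by fastforce
  have cF: "card F \<le> card (\<Union>M) * t"
  proof (rule card_le_cover[OF F V(1)])
    show "finite (\<Union>M)" using fM M2 by auto
    show "e \<inter> \<Union>M \<noteq> {}" if "e \<in> F" for e
    proof -
      have "card e = 2" using that F by (auto simp: nsets_def)
      then show ?thesis using M(3)[OF that] by (cases "e = {}") simp_all
    qed
    show "card (nbh F x) \<le> t" if "x \<in> \<Union>M" for x
    proof -
      have x: "x \<in> A" using that M2 by blast
      then have "nbh F x = nbh H x \<inter> A" by (auto simp: nbh_iff F_def)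
      then show ?thesis using t_ge[OF x] by simp
    qed
  qed
  also have "card (\<Union>M) \<le> 2 * card M"
    using card_Union_le_sum_card[of M] M2 by simp
  finally have "real (card F) \<le> real (2 * card M * t)" by (metis mult_le_mono1 le_trans of_nat_mono)
  then have cF: "real (card F) \<le> 2 * real (card M) * t" by simp
  show ?thesis
  proof (cases "real (card M) \<ge> k0")
    case True
    have "real t \<le> D"
    proof (rule ccontr)
      assume "\<not> ?thesis"
      then have D: "D < real t" by simp
      moreover have D0: "t0 \<le> D" "D > 0" using par pos by (auto simp: D_def)
      ultimately have "q / 2 * D\<^sup>2 < q / 2 * (real t)\<^sup>2"
        using pq by (intro mult_strict_left_mono power_strict_mono) auto
      also have "\<dots> \<le> 12 * \<tau> / q * n\<^sup>2" using tq few D D0 by linarith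
      also have "\<dots> < q / 2 * (q\<^sup>2 / 320)\<^sup>2 * n\<^sup>2"
        using par(1) n_pos by (intro mult_strict_right_mono) auto
      also have "\<dots> = q / 2 * D\<^sup>2" unfolding D_def power_mult_distrib by (simp only: mult.assoc)
      finally show False by simp
    qed
    then have "8 * real (card F) \<le> 16 * real (card M) * D"
      using cF mult_left_mono[of "real t" D "16 * real (card M)"] by linarith
    also have "\<dots> = q\<^sup>2 / 20 * card M * n" by (simp add: D_def)
    also have "\<dots> \<le> real (card (cut E A - H))"
      using matching_bound[OF H A _ M(2) True] M(1) by (simp add: F_def)
    finally show ?thesis using pos by (simp add: F_def add_increasing2)
  next
    case False
    then have F1: "8 * real (card F) \<le> 16 * k0 * t"
      using cF mult_right_mono[of "real (card M)" k0 "real t"] by simp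
    show ?thesis
    proof (cases "real t \<ge> t0")
      case True
      have "32 * k0 * t \<le> q * t0 * t" using par(3) by (intro mult_right_mono) auto
      also have "\<dots> \<le> q * t * t" using True pq by (intro mult_right_mono mult_left_mono) auto
      finally have "16 * k0 * t \<le> q / 2 * (real t)\<^sup>2" by (simp add: power2_eq_square)
      moreover have "0 \<le> 16 * k0 * t0" using pos by simp
      ultimately show ?thesis using F1 tq[OF True] unfolding F_def by linarith
    next
      case False
      then have "16 * k0 * t \<le> 16 * k0 * t0" using pos by simp
      then show ?thesis using F1 unfolding F_def by linarith
    qed
  qed
qed

text \<open>Let \<open>A\<close> be a maximum cut of \<open>H\<close>, \<open>f\<close> the number
  of edges of \<open>H\<close> inside the parts and \<open>m\<close> the number of crossing edges of
  \<open>E\<close> missing from \<open>H\<close>. Optimality of \<open>H\<close> gives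
  \<open>m \<le> f\<close>, and \<open>inner_edges_bound\<close> on both sides gives
  \<open>4 * f \<le> m + 16 * k0 * t0\<close>, so both are below \<open>\<zeta>\<close>. An inner
  edge of \<open>H\<close> with at least \<open>\<zeta>\<close> common neighbours across would make
  \<open>m\<close> too large. With fewer, \<open>defect\<close> yields a cut of \<open>E\<close>
  with more edges than \<open>H\<close>.\<close>

lemma maximum_triangle_free_is_cut:
  assumes H: "H \<subseteq> E" "tri_free H" and opt: "\<And>X. X \<subseteq> V \<Longrightarrow> card (cut E X) \<le> card H"
  shows "\<exists>A\<subseteq>V. H = cut H A"
proof -
  have HV: "H \<subseteq> nsets V 2" using H E by auto
  have fH: "finite H" using finite_subset[OF H(1) finite_E] .
  have big: "real (card H) \<ge> p * n\<^sup>2 / 4 - 2 * \<tau> * n\<^sup>2"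
    using cut_lower opt by (meson of_nat_mono order_trans)
  obtain A0 where A0: "A0 \<subseteq> V" "real (card (H - cut H A0)) \<le> 9 * \<tau> / q * n\<^sup>2"
    using near_bipartite[OF H big] .
  obtain A where "A \<in> Pow V" "\<And>X. X \<in> Pow V \<Longrightarrow> card (cut H X) \<le> card (cut H A)"
    using ex_max_on[of "Pow V" "\<lambda>X. card (cut H X)"] V by blast
  then have A: "A \<subseteq> V" "\<And>X. X \<subseteq> V \<Longrightarrow> card (cut H X) \<le> card (cut H A)" by auto
  define f where "f = real (card (H - cut H A))"
  define m where "m = real (card (cut E A - H))"
  have cutsub: "cut H X \<subseteq> H" for X by (rule cut_subset)
  have "card (H - cut H A) \<le> card (H - cut H A0)"
    using A(2)[OF A0(1)] card_Diff_subset[OF finite_subset[OF cutsub fH] cutsub] by simp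
  then have f9: "f \<le> 9 * \<tau> / q * n\<^sup>2" using A0(2) by (simp add: f_def)
  \<comment> \<open>Both sides of \<open>eq\<close> below count the edges of
    \<open>H \<union> cut E A\<close>.\<close>
  have "H = (cut E A \<inter> H) \<union> (H - cut H A)" "(cut E A \<inter> H) \<inter> (H - cut H A) = {}"
    using H(1) by (auto simp: cut_def)
  then have "card H = card (cut E A \<inter> H) + card (H - cut H A)"
    using fH by (metis card_Un_disjoint finite_Diff finite_Int)
  moreover have "card (cut E A) = card (cut E A \<inter> H) + card (cut E A - H)"
    using card_Diff_subset_Int[of "cut E A" H] finite_subset[OF cut_subset finite_E]
      card_mono[of "cut E A" "cut E A \<inter> H"] by auto
  ultimately have eq: "real (card H) + m = real (card (cut E A)) + f"
    unfolding m_def f_def by linarith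
  have q1: "1 \<le> 1 / q" using pq by simp
  have tq: "\<tau> * n\<^sup>2 \<le> \<tau> / q * n\<^sup>2" using q1 pos mult_right_mono[OF q1, of "\<tau> * n\<^sup>2"] by simp
  have cl: "real (card A) * real (card (V - A)) \<le> n\<^sup>2 / 4" using card_mult_compl_le[OF V(1) A(1)] by simp
  have cu: "real (card (cut E A)) \<le> p * (real (card A) * real (card (V - A))) + \<tau> * n\<^sup>2"
    using cut_upper[OF A(1)] .
  also have "\<dots> \<le> p * (n\<^sup>2 / 4) + \<tau> * n\<^sup>2" using cl pq by (intro add_right_mono mult_left_mono) auto
  finally have m12: "m \<le> 12 * \<tau> / q * n\<^sup>2" using eq big f9 tq by (simp add: algebra_simps)
  have par1: "12 * \<tau> / q < q / 20"
  proof -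
    have "(q\<^sup>2 / 320)\<^sup>2 \<le> 1 / 320" using pq by (simp add: power2_eq_square field_simps mult_le_one order_trans[of _ 1 320])
    then have "q / 2 * (q\<^sup>2 / 320)\<^sup>2 \<le> q / 2 * (1 / 320)" using pq by (intro mult_left_mono) auto
    then show ?thesis using par(1) pq(1) by linarith
  qed
  \<comment> \<open>Balance of the parts: \<open>cut E A\<close> falls short of
    \<open>p * n\<^sup>2 / 4\<close> only by the error terms, so the product of the part sizes is at
    least \<open>n\<^sup>2 / 5\<close>, by \<open>1 / 4 - 1 / 20 = 1 / 5\<close>.\<close>
  have "p * n\<^sup>2 / 4 - 12 * \<tau> / q * n\<^sup>2 \<le> p * (real (card A) * real (card (V - A)))"
  proof -
    have "m \<ge> 0" by (simp add: m_def)
    moreover have "9 * \<tau> / q * n\<^sup>2 = 9 * (\<tau> / q * n\<^sup>2)" "12 * \<tau> / q * n\<^sup>2 = 12 * (\<tau> / q * n\<^sup>2)"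
      "2 * \<tau> * n\<^sup>2 = 2 * (\<tau> * n\<^sup>2)" by simp_all
    ultimately show ?thesis using cu eq big f9 tq by linarith
  qed
  moreover have "12 * \<tau> / q * n\<^sup>2 \<le> q / 20 * n\<^sup>2" using par1 by (intro mult_right_mono) auto
  moreover have "q / 20 * n\<^sup>2 \<le> p / 20 * n\<^sup>2" using pq by (intro mult_right_mono) auto
  ultimately have "p * (n\<^sup>2 / 5) \<le> p * (real (card A) * real (card (V - A)))" by simp
  then have bal: "n\<^sup>2 / 5 \<le> real (card A) * real (card (V - A))"
    using pq by (simp add: mult_le_cancel_left_pos)
  have bound: "n / 5 \<le> b" if "n\<^sup>2 / 5 \<le> a * b" "0 \<le> b" "a \<le> n" for a b :: real
  proof -
    have "n * (n / 5) \<le> n * b" using that mult_right_mono[OF that(3,2)] by (simp add: power2_eq_square)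
    then show ?thesis using n_pos by (simp only: mult_le_cancel_left_pos)
  qed
  have cAB: "real (card A) \<le> n" "real (card (V - A)) \<le> n"
    using A(1) V(1) by (auto intro: card_mono)
  have VA: "V - (V - A) = A" using A(1) by auto
  have b1: "real (card (V - A)) \<ge> n / 5" by (rule bound[OF bal]) (use cAB in auto)
  have b2: "real (card (V - (V - A))) \<ge> n / 5" unfolding VA
    by (rule bound[of "real (card (V - A))"]) (use bal cAB in \<open>auto simp: mult.commute\<close>)
  \<comment> \<open>The complement defines the same cut, so \<open>inner_edges_bound\<close> applies
    to either part.\<close>
  have cutE: "cut E (V - A) = cut E A" and cutH: "cut H (V - A) = cut H A"
    using cut_compl[OF E A(1)] cut_compl[OF HV A(1)] .
  have "8 * real (card (H \<inter> Pow A)) \<le> m + 16 * k0 * t0"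
    unfolding m_def using inner_edges_bound[OF H A(1) b1 A(2)] m12 by (simp add: m_def)
  moreover have "8 * real (card (H \<inter> Pow (V - A))) \<le> m + 16 * k0 * t0"
    using inner_edges_bound[OF H Diff_subset b2] A(2) m12 by (simp add: m_def cutE cutH)
  moreover have "f \<le> real (card (H \<inter> Pow A)) + real (card (H \<inter> Pow (V - A)))"
  proof -
    have "H - cut H A \<subseteq> H \<inter> Pow A \<union> H \<inter> Pow (V - A)"
      using HV by (auto simp: cut_def nsets_def)
    then have "card (H - cut H A) \<le> card (H \<inter> Pow A \<union> H \<inter> Pow (V - A))"
      using fH by (intro card_mono) auto
    also have "\<dots> \<le> card (H \<inter> Pow A) + card (H \<inter> Pow (V - A))" by (rule card_Un_le)
    finally show ?thesis by (simp add: f_def)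
  qed
  ultimately have f_le: "4 * f \<le> m + 16 * k0 * t0" by linarith
  have m_le_f: "real (card (cut E X)) - real (card (cut E A)) + m \<le> f" if "X \<subseteq> V" for X
    using opt[OF that] eq by linarith
  have m_f: "m \<le> f" using m_le_f[OF A(1)] by simp
  have m0: "0 \<le> m" by (simp add: m_def)
  have small: "m < \<zeta>" "f < \<zeta>"
  proof -
    have "m \<le> 6 * k0 * t0 \<and> f \<le> 6 * k0 * t0" using f_le m_f pos mult_pos_pos[OF pos(2,3)] by linarith
    then show "m < \<zeta>" "f < \<zeta>" using par(4) by auto
  qed
  have no_inner: "\<not> (x \<in> B \<and> y \<in> B)" if B: "B = A \<or> B = V - A" and xy: "{x, y} \<in> H" for B x y
  proof
    assume xyB: "x \<in> B \<and> y \<in> B"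
    have BV: "B \<subseteq> V" and cB: "cut E B = cut E A" using B A(1) cutE by auto
    have "{x, y} \<in> nsets V 2" using xy HV by blast
    then have ne: "x \<noteq> y" by simp
    show False
    proof (cases "real (card (nbh E x \<inter> nbh E y - B)) < \<zeta>")
      case True
      have "\<exists>X\<subseteq>V. real (card (cut E X)) \<ge> real (card (cut E B)) + \<zeta>"
        using defect[OF BV _ _ ne True] xyB by simp
      then obtain X where "X \<subseteq> V" "real (card (cut E X)) \<ge> real (card (cut E A)) + \<zeta>"
        unfolding cB by (elim exE conjE)
      then show False using m_le_f[of X] small m0 by linarith
    next
      case False
      let ?Z = "nbh E x \<inter> nbh E y - B"
      \<comment> \<open>One of the two edges at a common neighbour \<open>z\<close> is missing from
        \<open>H\<close>. \<open>?g\<close> picks it, and \<open>z\<close> is its only end outside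
        \<open>B\<close>, whence injectivity.\<close>
      let ?g = "\<lambda>z. if {x, z} \<in> H then {y, z} else {x, z}"
      have gB: "?g z - B = {z}" if "z \<in> ?Z" for z
        using that xyB by (simp add: insert_Diff_if)
      have "inj_on ?g ?Z"
      proof (rule inj_onI)
        fix z z' assume z: "z \<in> ?Z" "z' \<in> ?Z" "?g z = ?g z'"
        have "?g z - B = ?g z' - B" by (rule arg_cong[OF z(3)])
        then show "z = z'" unfolding gB[OF z(1)] gB[OF z(2)] by (rule singleton_inject)
      qed
      moreover have "?g ` ?Z \<subseteq> cut E B - H"
      proof
        fix e assume "e \<in> ?g ` ?Z"
        then obtain z where z: "e = ?g z" "z \<in> ?Z" by (rule imageE)
        have "\<not> ({x, z} \<in> H \<and> {y, z} \<in> H)" using xy H(2) unfolding tri_free_def by blast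
        then show "e \<in> cut E B - H"
          using z xyB by (simp add: doubleton_in_cut nbh_iff)
      qed
      moreover have "finite (cut E B - H)" using finite_subset[OF cut_subset finite_E] by simp
      ultimately have "card ?Z \<le> card (cut E B - H)" by (rule card_inj_on_le)
      then show False using False small unfolding cB m_def by linarith
    qed
  qed
  have "H = cut H A"
  proof (rule antisym)
    show "H \<subseteq> cut H A"
    proof
      fix e assume e: "e \<in> H"
      then obtain x y where xy: "e = {x, y}" "x \<in> V" "y \<in> V" using edgeE[OF HV] by blast
      then show "e \<in> cut H A" using e no_inner[of A x y] no_inner[of "V - A" x y]
        by (auto simp: doubleton_in_cut)
    qed
  qed (rule cut_subset)
  then show ?thesis using A(1) by blast
qed

end

subsection \<open>Concentration for products of Bernoulli variables\<close>

lemma prob_Pi_bernoulli_all: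
  assumes "finite I" "J \<subseteq> I" "0 \<le> p" "p \<le> 1"
  shows "measure_pmf.prob (Pi_pmf I False (\<lambda>_. bernoulli_pmf p)) {b. \<forall>e\<in>J. b e} = p ^ card J"
proof -
  let ?B = "\<lambda>e. if e \<in> J then {True} else UNIV"
  have "{b. \<forall>e\<in>J. b e} = Pi I ?B" using assms(2) by (auto simp: Pi_def)
  then have "measure_pmf.prob (Pi_pmf I False (\<lambda>_. bernoulli_pmf p)) {b. \<forall>e\<in>J. b e} =
      (\<Prod>e\<in>I. measure_pmf.prob (bernoulli_pmf p) (?B e))"
    using measure_Pi_pmf_Pi[OF assms(1)] by simp
  also have "\<dots> = (\<Prod>e\<in>I. if e \<in> J then p else 1)"
    using assms(3,4) by (intro prod.cong refl) (simp add: measure_pmf_single)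
  also have "\<dots> = p ^ card J"
    using assms(1,2) by (simp add: prod.If_cases Int_absorb1)
  finally show ?thesis .
qed

text \<open>Events about disjoint sets of independent bits are independent. Writing the indicator as
  a product over the block exhibits it as a measurable function of the restriction to that
  block.\<close>

lemma indep_vars_blocks:
  fixes p :: real and J :: "'i \<Rightarrow> 'e set"
  assumes "finite I" "\<And>i. i \<in> T \<Longrightarrow> J i \<subseteq> I" "disjoint_family_on J T"
  defines "P \<equiv> Pi_pmf I False (\<lambda>_. bernoulli_pmf p)"
  shows "prob_space.indep_vars (measure_pmf P) (\<lambda>_. borel) (\<lambda>i b. of_bool (\<forall>e\<in>J i. b e) :: real) T"
proof -
  have "prob_space.indep_vars (measure_pmf P) (\<lambda>_. count_space UNIV) (\<lambda>x f. f x) I"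
    unfolding P_def by (rule indep_vars_Pi_pmf[OF assms(1)])
  from prob_space.indep_vars_restrict[OF measure_pmf.prob_space_axioms this assms(2,3)]
  have 1: "prob_space.indep_vars (measure_pmf P) (\<lambda>j. PiM (J j) (\<lambda>_. count_space UNIV)) (\<lambda>j \<omega>. restrict (\<lambda>i. \<omega> i) (J j)) T" .
  have "prob_space.indep_vars (measure_pmf P) (\<lambda>_. borel) (\<lambda>i b. (\<Prod>e\<in>J i. of_bool ((restrict (\<lambda>i. b i) (J i)) e)) :: real) T"
  proof (rule prob_space.indep_vars_compose2[OF measure_pmf.prob_space_axioms 1])
    fix i assume "i \<in> T"
    show "(\<lambda>h. \<Prod>e\<in>J i. of_bool (h e)) \<in> (\<Pi>\<^sub>M _\<in>J i. count_space UNIV) \<rightarrow>\<^sub>M (borel :: real measure)"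
    proof (rule borel_measurable_prod)
      fix e assume e: "e \<in> J i"
      have "(\<lambda>h. h e) \<in> (\<Pi>\<^sub>M _\<in>J i. count_space (UNIV :: bool set)) \<rightarrow>\<^sub>M count_space UNIV"
        using e by (rule measurable_component_singleton)
      then show "(\<lambda>h. of_bool (h e)) \<in> (\<Pi>\<^sub>M _\<in>J i. count_space UNIV) \<rightarrow>\<^sub>M (borel :: real measure)"
        by (rule measurable_compose) simp
    qed
  qed
  moreover have "(\<Prod>e\<in>J i. of_bool ((restrict (\<lambda>i. b i) (J i)) e)) = (of_bool (\<forall>e\<in>J i. b e) :: real)"
    if "i \<in> T" for i b
  proof -
    have fin: "finite (J i)" by (rule finite_subset[OF assms(2)[OF that] assms(1)])
    have "(\<Prod>e\<in>J i. of_bool ((restrict (\<lambda>i. b i) (J i)) e)) = (\<Prod>e\<in>J i. (of_bool (b e) :: real))"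
      by (rule prod.cong) auto
    also have "\<dots> = of_bool (\<forall>e\<in>J i. b e)"
    proof (cases "\<forall>e\<in>J i. b e")
      case False
      then show ?thesis using fin by (auto intro!: prod_zero)
    qed simp
    finally show ?thesis .
  qed
  ultimately show ?thesis
    by (subst prob_space.indep_vars_cong[OF measure_pmf.prob_space_axioms, where J = T and N' = "\<lambda>_. borel" and
        Y = "\<lambda>i b. \<Prod>e\<in>J i. of_bool ((restrict (\<lambda>i. b i) (J i)) e)"]) (auto simp: fun_eq_iff)
qed

text \<open>Hoeffding's inequality for independent indicators of mean \<open>p ^ s\<close>. Blocks
  of one edge count edges, and blocks of two edges at a common vertex count common
  neighbours.\<close>

lemma block_concentration:
  fixes J :: "'i \<Rightarrow> 'e set" and p \<epsilon> :: real
  assumes I: "finite I" "\<And>i. i \<in> T \<Longrightarrow> J i \<subseteq> I" "\<And>i. i \<in> T \<Longrightarrow> card (J i) = s"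
    and T: "finite T" "T \<noteq> {}" "disjoint_family_on J T"
    and p: "0 \<le> p" "p \<le> 1" and \<epsilon>: "\<epsilon> \<ge> 0"
  shows "measure_pmf.prob (Pi_pmf I False (\<lambda>_. bernoulli_pmf p))
     {b. \<bar>real (card {i \<in> T. \<forall>e\<in>J i. b e}) - real (card T) * p ^ s\<bar> \<ge> \<epsilon>} \<le> 2 * exp (- 2 * \<epsilon>\<^sup>2 / card T)"
proof -
  let ?P = "Pi_pmf I False (\<lambda>_. bernoulli_pmf p)"
  let ?X = "\<lambda>i b. of_bool (\<forall>e\<in>J i. b e) :: real"
  have E: "measure_pmf.expectation ?P (?X i) = p ^ s" if "i \<in> T" for i
  proof -
    have "measure_pmf.expectation ?P (?X i) = measure_pmf.expectation ?P (indicator {b. \<forall>e\<in>J i. b e})"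
      by (rule Bochner_Integration.integral_cong) (auto simp: indicator_def)
    also have "\<dots> = p ^ s"
      using prob_Pi_bernoulli_all[OF I(1) I(2)[OF that] p] I(3)[OF that] by simp
    finally show ?thesis .
  qed
  interpret Hoeffding_ineq "measure_pmf ?P" T ?X "\<lambda>_. 0" "\<lambda>_. 1" "real (card T) * p ^ s"
  proof (unfold_locales)
    show "prob_space.indep_vars (measure_pmf ?P) (\<lambda>_. borel) ?X T"
      by (rule indep_vars_blocks[OF I(1,2) T(3)])
  qed (use T E in auto)
  have "(\<Sum>i\<in>T. ?X i b) = real (card {i \<in> T. \<forall>e\<in>J i. b e})" for b
    using T(1) by (simp add: of_bool_def sum.If_cases Int_def)
  then show ?thesis
    using Hoeffding_ineq_abs_ge[OF \<epsilon>] T by (simp add: card_gt_0_iff)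
qed

text \<open>Exposure in stages: a bound for the bits of \<open>B\<close> that holds whatever values
  \<open>f\<close> the bits of \<open>A\<close> take is averaged over \<open>f\<close>. This
  replaces conditional probabilities.\<close>

lemma prob_Pi_pmf_Un_le:
  assumes fin: "finite A" "finite B" "A \<inter> B = {}" and "\<epsilon> \<ge> 0"
    and bound: "\<And>f. measure_pmf.prob (Pi_pmf B d P) {g. (\<lambda>x. if x \<in> A then f x else g x) \<in> S} \<le> \<epsilon>"
  shows "measure_pmf.prob (Pi_pmf (A \<union> B) d P) S \<le> \<epsilon>"
proof -
  let ?Q = "\<lambda>f. map_pmf (\<lambda>g x. if x \<in> A then f x else g x) (Pi_pmf B d P)"
  have "Pi_pmf (A \<union> B) d P = bind_pmf (Pi_pmf A d P) ?Q"
    unfolding Pi_pmf_union[OF fin] pair_pmf_def map_pmf_def by (simp add: bind_assoc_pmf bind_return_pmf)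
  then have "emeasure (measure_pmf (Pi_pmf (A \<union> B) d P)) S = (\<integral>\<^sup>+f. emeasure (measure_pmf (?Q f)) S \<partial>measure_pmf (Pi_pmf A d P))"
    by (simp only: emeasure_bind_pmf)
  also have "\<dots> \<le> (\<integral>\<^sup>+f. ennreal \<epsilon> \<partial>measure_pmf (Pi_pmf A d P))"
  proof (rule nn_integral_mono)
    fix f
    show "emeasure (measure_pmf (?Q f)) S \<le> ennreal \<epsilon>"
      using bound[of f] by (simp add: measure_pmf.emeasure_eq_measure vimage_def ennreal_leI)
  qed
  also have "\<dots> = ennreal \<epsilon>" by (simp add: measure_pmf.emeasure_space_1)
  finally show ?thesis using \<open>\<epsilon> \<ge> 0\<close> by (simp add: measure_pmf.emeasure_eq_measure)
qed

lemma prob_UN_le: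
  fixes P :: "'b pmf"
  assumes "finite T" "\<And>i. i \<in> T \<Longrightarrow> measure_pmf.prob P (B i) \<le> \<epsilon> i"
  shows "measure_pmf.prob P (\<Union>i\<in>T. B i) \<le> (\<Sum>i\<in>T. \<epsilon> i)"
proof -
  have "measure_pmf.prob P (\<Union>i\<in>T. B i) \<le> (\<Sum>i\<in>T. measure_pmf.prob P (B i))"
    using assms(1) by (intro measure_pmf.finite_measure_subadditive_finite) auto
  also have "\<dots> \<le> (\<Sum>i\<in>T. \<epsilon> i)" using assms(2) by (rule sum_mono)
  finally show ?thesis .
qed

lemma prob_mono:
  fixes P :: "'b pmf"
  assumes "A \<subseteq> B" "measure_pmf.prob P B \<le> \<epsilon>"
  shows "measure_pmf.prob P A \<le> \<epsilon>"
  using measure_pmf.finite_measure_mono[of A B P] assms by simp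

subsection \<open>Cuts with few common neighbours across\<close>

text \<open>The graph before the edges from \<open>x\<close> to the neighbours of \<open>y\<close>
  are exposed. Without \<open>{x, y}\<close>, moving \<open>x\<close> across a cut does not change
  the balance of neighbours at \<open>y\<close>.\<close>

definition detach :: "'a set set \<Rightarrow> 'a \<Rightarrow> 'a \<Rightarrow> 'a set set" where
  "detach E x y = {e \<in> E. e \<noteq> {x, y} \<and> (\<forall>v\<in>nbh E y. e \<noteq> {x, v})}"

text \<open>A choice function makes the cut a function of the edge set. Applied to
  \<open>detach E x y\<close>, it is therefore independent of the edges from \<open>x\<close> to the
  neighbours of \<open>y\<close>.\<close>

definition best_cut :: "'a set \<Rightarrow> 'a set set \<Rightarrow> 'a \<Rightarrow> 'a \<Rightarrow> 'a set" where
  "best_cut V E x y = (SOME A. A \<subseteq> V \<and> x \<in> A \<and> y \<in> A \<and>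
     (\<forall>X\<subseteq>V. x \<in> X \<longrightarrow> y \<in> X \<longrightarrow> card (cut E X) \<le> card (cut E A)))"

lemma best_cut:
  assumes "finite V" "x \<in> V" "y \<in> V"
  shows "best_cut V E x y \<subseteq> V" "x \<in> best_cut V E x y" "y \<in> best_cut V E x y"
    "\<And>X. X \<subseteq> V \<Longrightarrow> x \<in> X \<Longrightarrow> y \<in> X \<Longrightarrow> card (cut E X) \<le> card (cut E (best_cut V E x y))"
proof -
  let ?S = "{X. X \<subseteq> V \<and> x \<in> X \<and> y \<in> X}"
  have "finite ?S" using assms(1) by simp
  moreover have "V \<in> ?S" using assms by simp
  ultimately have "\<exists>A\<in>?S. \<forall>X\<in>?S. card (cut E X) \<le> card (cut E A)"
    by (intro ex_max_on) auto
  then have "\<exists>A. A \<subseteq> V \<and> x \<in> A \<and> y \<in> A \<and>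
     (\<forall>X\<subseteq>V. x \<in> X \<longrightarrow> y \<in> X \<longrightarrow> card (cut E X) \<le> card (cut E A))" by auto
  from someI_ex[OF this]
  show "best_cut V E x y \<subseteq> V" "x \<in> best_cut V E x y" "y \<in> best_cut V E x y"
    "\<And>X. X \<subseteq> V \<Longrightarrow> x \<in> X \<Longrightarrow> y \<in> X \<Longrightarrow> card (cut E X) \<le> card (cut E (best_cut V E x y))"
    unfolding best_cut_def[symmetric] by simp_all
qed

lemma nbh_detach_y: "x \<noteq> y \<Longrightarrow> nbh (detach E x y) y = nbh E y - {x}"
  by (auto simp: nbh_iff detach_def doubleton_eq_iff)

lemma doubleton_left_cancel: "{x, z} = {x, v} \<longleftrightarrow> z = v"
  by (auto simp: doubleton_eq_iff)

lemma nbh_detach_x: "nbh (detach E x y) x = nbh E x - nbh E y - {y}"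
  by (rule set_eqI) (auto simp only: nbh_iff detach_def mem_Collect_eq doubleton_left_cancel Diff_iff singleton_iff)

text \<open>Among the removed edges, those that cross \<open>A\<close> lead from \<open>x\<close> to
  common neighbours outside \<open>A\<close>, whereas \<open>{x, y}\<close> lies inside.\<close>

lemma card_cut_detach:
  assumes E: "E \<subseteq> nsets V 2" "finite V" and A: "x \<in> A" "y \<in> A"
  shows "card (cut E A) = card (cut (detach E x y) A) + card (nbh E x \<inter> nbh E y - A)"
proof -
  let ?Z = "nbh E x \<inter> nbh E y - A"
  have inj: "inj_on (\<lambda>v. {x, v}) B" for B by (auto simp: inj_on_def doubleton_eq_iff)
  have fin: "finite (cut (detach E x y) A)" "finite ?Z"
    using finite_subset[OF _ finite_edges[OF E]] finite_nbh[OF E]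
    by (auto simp: cut_def detach_def)
  have dis: "cut (detach E x y) A \<inter> (\<lambda>v. {x, v}) ` ?Z = {}"
    by (auto simp: cut_def detach_def)
  have "e \<in> cut E A \<longleftrightarrow> e \<in> cut (detach E x y) A \<union> (\<lambda>v. {x, v}) ` ?Z" for e
  proof -
    have "e \<in> (\<lambda>v. {x, v}) ` ?Z" if "e \<in> cut E A" "e \<notin> cut (detach E x y) A"
    proof -
      have "e \<noteq> {x, y}" "e \<in> E" "e \<notin> detach E x y"
        using that A by (auto simp: cut_def)
      then have "\<exists>v\<in>nbh E y. e = {x, v}" by (simp add: detach_def)
      then obtain v where v: "v \<in> nbh E y" "e = {x, v}" by (rule bexE)
      then show ?thesis using that(1) A by (auto simp: cut_def nbh_iff)
    qed
    moreover have "{x, v} \<in> cut E A" if "v \<in> ?Z" for v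
      using that A by (simp add: doubleton_in_cut nbh_iff)
    moreover have "cut (detach E x y) A \<subseteq> cut E A" by (auto simp: cut_def detach_def)
    ultimately show ?thesis by blast
  qed
  then have "cut E A = cut (detach E x y) A \<union> (\<lambda>v. {x, v}) ` ?Z" by blast
  then show ?thesis
    using card_Un_disjoint[OF fin(1) finite_imageI[OF fin(2)] dis] card_image[OF inj] by simp
qed

text \<open>Otherwise moving \<open>x\<close> and \<open>y\<close> to the other side would improve the best cut.\<close>

lemma best_cut_detach_degree:
  assumes E: "E \<subseteq> nsets V 2" "finite V" and xy: "x \<in> V" "y \<in> V" "x \<noteq> y"
  defines "A \<equiv> best_cut V (detach E x y) x y"
  shows "card (nbh E y - {x}) \<le> 2 * card (nbh E y - A) + card (nbh E x - nbh E y - {y})"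
proof -
  let ?D = "detach E x y"
  have D: "?D \<subseteq> nsets V 2" using E by (auto simp: detach_def)
  have A: "A \<subseteq> V" "x \<in> A" "y \<in> A"
    "\<And>X. X \<subseteq> V \<Longrightarrow> x \<in> X \<Longrightarrow> y \<in> X \<Longrightarrow> card (cut ?D X) \<le> card (cut ?D A)"
    unfolding A_def by (rule best_cut[OF E(2) xy(1,2)]; assumption)+
  \<comment> \<open>Moving both \<open>x\<close> and \<open>y\<close> puts them together on the
    other side. Passing to the complement gives a set containing both, which competes with
    \<open>A\<close>.\<close>
  have "card (cut ?D (A - {x} - {y})) = card (cut ?D (V - (A - {x} - {y})))"
    using cut_compl[OF D, of "A - {x} - {y}"] A(1) by (simp add: subset_iff)
  also have "\<dots> \<le> card (cut ?D A)" using xy by (intro A(4)) auto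
  finally have le: "card (cut ?D (A - {x} - {y})) \<le> card (cut ?D A)" .
  \<comment> \<open>As \<open>x\<close> and \<open>y\<close> are not adjacent in \<open>?D\<close>,
    the two moves do not interact.\<close>
  have nx: "x \<notin> nbh ?D y" "y \<notin> nbh ?D x" using xy by (auto simp: nbh_detach_x nbh_detach_y)
  then have e: "nbh ?D y \<inter> (A - {x}) = nbh ?D y \<inter> A" "nbh ?D y - (A - {x}) = nbh ?D y - A" by auto
  have y: "y \<in> A - {x}" using A xy by auto
  have 1: "card (nbh ?D x \<inter> A) + card (nbh ?D y \<inter> A) \<le> card (nbh ?D x - A) + card (nbh ?D y - A)"
    using card_cut_move[OF D E(2) A(2)] card_cut_move[OF D E(2) y] le unfolding e by linarith
  have s: "card (nbh ?D z) = card (nbh ?D z \<inter> A) + card (nbh ?D z - A)" for z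
    using card_Int_Diff[OF finite_nbh[OF D E(2)]] by metis
  have "nbh ?D y - A = nbh E y - A" using A by (auto simp: nbh_detach_y xy)
  then show ?thesis using 1 s[of x] s[of y] xy
    by (simp add: nbh_detach_y nbh_detach_x)
qed

text \<open>In the detached graph the best cut is at least as large as that of \<open>A\<close>.
  Putting the removed edges back adds at least \<open>2 * \<zeta>\<close> to the former and less
  than \<open>\<zeta>\<close> to the latter.\<close>

lemma defect_from_best_cut:
  fixes \<zeta> :: real
  assumes E: "E \<subseteq> nsets V 2" "finite V" and A: "A \<subseteq> V" "x \<in> A" "y \<in> A" "x \<noteq> y"
    and few: "real (card (nbh E x \<inter> nbh E y - A)) < \<zeta>"
    and many: "real (card (nbh E x \<inter> nbh E y - best_cut V (detach E x y) x y)) \<ge> 2 * \<zeta>"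
  shows "\<exists>X\<subseteq>V. real (card (cut E X)) \<ge> real (card (cut E A)) + \<zeta>"
proof -
  let ?B = "best_cut V (detach E x y) x y"
  have xy: "x \<in> V" "y \<in> V" using A by auto
  note B = best_cut[OF E(2) xy, where E = "detach E x y"]
  have "card (cut (detach E x y) A) \<le> card (cut (detach E x y) ?B)" using B(4)[OF A(1-3)] .
  then have "real (card (cut E ?B)) \<ge> real (card (cut E A)) + \<zeta>"
    using few many unfolding card_cut_detach[OF E A(2,3)] card_cut_detach[OF E B(2,3)] by simp
  then show ?thesis using B(1) by blast
qed

section \<open>Pairs between disjoint vertex sets\<close>

lemma card_between_complete:
  assumes V: "S \<subseteq> V" "T \<subseteq> V" and dis: "S \<inter> T = {}"
  shows "card (between (nsets V 2) S T) = card S * card T"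
proof -
  have "bij_betw (\<lambda>(x, y). {x, y}) (S \<times> T) (between (nsets V 2) S T)"
    unfolding bij_betw_def
  proof
    show "inj_on (\<lambda>(x, y). {x, y}) (S \<times> T)"
      using dis by (auto simp: inj_on_def doubleton_eq_iff)
    show "(\<lambda>(x, y). {x, y}) ` (S \<times> T) = between (nsets V 2) S T"
      using V dis by (auto simp: between_def image_iff)
  qed
  from bij_betw_same_card[OF this] show ?thesis by (simp add: card_cartesian_product)
qed

lemma cut_eq_between: "E \<subseteq> nsets V 2 \<Longrightarrow> cut E A = between E A (V - A)"
proof -
  assume E: "E \<subseteq> nsets V 2"
  have "e \<in> cut E A \<longleftrightarrow> e \<in> between E A (V - A)" for e
  proof (cases "e \<in> E")
    case True
    then obtain a b where ab: "e = {a, b}" "a \<noteq> b" "a \<in> V" "b \<in> V" using edgeE[OF E] by blast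
    have "(\<exists>x\<in>A. \<exists>y\<in>V - A. {a, b} = {x, y}) \<longleftrightarrow> (a \<in> A \<longleftrightarrow> b \<notin> A)"
      using ab by (auto simp: doubleton_eq_iff)
    then show ?thesis using True ab(1) by (simp add: doubleton_in_cut between_def)
  qed (auto simp: cut_def between_def)
  then show ?thesis by blast
qed

subsection \<open>A random graph is typical\<close>

abbreviation edge_bits :: "'a set \<Rightarrow> real \<Rightarrow> ('a set \<Rightarrow> bool) pmf" where
  "edge_bits V p \<equiv> Pi_pmf (nsets V 2) False (\<lambda>_. bernoulli_pmf p)"

abbreviation present :: "'a set \<Rightarrow> ('a set \<Rightarrow> bool) \<Rightarrow> 'a set set" where
  "present V b \<equiv> {e \<in> nsets V 2. b e}"

section \<open>Edge counts, matchings and common neighbours in the random graph\<close>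

lemma card_nsets_le_power: "finite V \<Longrightarrow> card (nsets V k) \<le> card V ^ k"
proof -
  assume V: "finite V"
  have "card (nsets V k) = card V choose k" by simp
  also have "\<dots> \<le> card V ^ k"
    by (cases "k \<le> card V") (auto intro: binomial_le_pow simp: binomial_eq_0)
  finally show ?thesis .
qed

lemma edge_concentration:
  fixes V :: "'a set" and p \<epsilon> :: real
  assumes V: "finite V" and C: "C \<subseteq> nsets V 2" "C \<noteq> {}" and p: "0 \<le> p" "p \<le> 1" and "\<epsilon> \<ge> 0"
  shows "measure_pmf.prob (edge_bits V p) {b. \<bar>real (card (present V b \<inter> C)) - p * card C\<bar> \<ge> \<epsilon>}
    \<le> 2 * exp (- 2 * \<epsilon>\<^sup>2 / card C)"
proof -
  have "present V b \<inter> C = {i \<in> C. \<forall>e\<in>{i}. b e}" for b using C(1) by auto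
  then show ?thesis
    using block_concentration[of "nsets V 2" C "\<lambda>e. {e}" 1 p \<epsilon>] finite_imp_finite_nsets[OF V]
      finite_edges[OF C(1) V] C p \<open>\<epsilon> \<ge> 0\<close>
    by (auto simp: disjoint_family_on_def mult.commute)
qed

lemma family_concentration:
  fixes V :: "'a set" and p \<tau> :: real
  assumes V: "finite V" "V \<noteq> {}" and p: "0 \<le> p" "p \<le> 1" and \<tau>: "\<tau> > 0"
    and F: "finite \<F>" "\<And>C. C \<in> \<F> \<Longrightarrow> C \<subseteq> nsets V 2"
  shows "measure_pmf.prob (edge_bits V p)
     {b. \<exists>C\<in>\<F>. \<bar>real (card (present V b \<inter> C)) - p * card C\<bar> > \<tau> * (real (card V))\<^sup>2}
     \<le> card \<F> * (2 * exp (- 2 * \<tau>\<^sup>2 * (real (card V))\<^sup>2))"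
proof -
  let ?n = "real (card V)"
  let ?B = "\<lambda>C. {b. \<bar>real (card (present V b \<inter> C)) - p * card C\<bar> > \<tau> * ?n\<^sup>2}"
  have n: "?n > 0" using V by (simp add: card_gt_0_iff)
  have "measure_pmf.prob (edge_bits V p) (?B C) \<le> 2 * exp (- 2 * \<tau>\<^sup>2 * ?n\<^sup>2)" if C: "C \<in> \<F>" for C
  proof (cases "C = {}")
    case True
    then have "?B C = {}" using \<tau> n by (auto simp: not_less)
    then show ?thesis by simp
  next
    case False
    have fC: "card C > 0" using False F(2)[OF C] V(1) finite_edges card_gt_0_iff by metis
    have "measure_pmf.prob (edge_bits V p) (?B C) \<le> 2 * exp (- 2 * (\<tau> * ?n\<^sup>2)\<^sup>2 / card C)"
      using edge_concentration[OF V(1) F(2)[OF C] False, of p "\<tau> * ?n\<^sup>2"] p \<tau>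
      by (intro prob_mono[of "?B C" "{b. \<tau> * ?n\<^sup>2 \<le> \<bar>real (card (present V b \<inter> C)) - p * card C\<bar>}"]) auto
    also have "\<dots> \<le> 2 * exp (- 2 * \<tau>\<^sup>2 * ?n\<^sup>2)"
    proof -
      \<comment> \<open>The trivial bound on \<open>card C\<close> makes the exponent uniform over
        the family.\<close>
      have "card C \<le> card V ^ 2"
        using order_trans[OF card_mono[OF finite_imp_finite_nsets[OF V(1)] F(2)[OF C]] card_nsets_le_power[OF V(1)]] .
      then have "real (card C) \<le> ?n\<^sup>2" by (metis of_nat_le_iff of_nat_power)
      then have "2 * \<tau>\<^sup>2 * ?n\<^sup>2 * card C \<le> 2 * \<tau>\<^sup>2 * ?n\<^sup>2 * ?n\<^sup>2"
        by (intro mult_left_mono) auto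
      then have "2 * \<tau>\<^sup>2 * ?n\<^sup>2 \<le> 2 * (\<tau> * ?n\<^sup>2)\<^sup>2 / card C"
        using fC by (simp add: pos_le_divide_eq power_mult_distrib power2_eq_square mult_ac)
      then show ?thesis by simp
    qed
    finally show ?thesis .
  qed
  from prob_UN_le[OF F(1) this]
  show ?thesis by (simp add: Collect_bex_eq)
qed

text \<open>Union bound for each size \<open>t\<close>: there are at most
  \<open>card V ^ (2 * t)\<close> pairs of sets, and a deviation by half the mean has probability at
  most \<open>2 / card V ^ (4 * t)\<close>, because \<open>t \<ge> t0\<close> makes
  \<open>q\<^sup>2 * t\<^sup>2 / 2\<close> at least \<open>4 * t * ln (card V)\<close>.\<close>

lemma dense_pairs_prob:
  fixes V :: "'a set" and q t0 :: real
  assumes V: "finite V" "V \<noteq> {}" and pq: "0 < q" "q \<le> p" "p \<le> 1" and t0: "t0 > 0" "q\<^sup>2 * t0 \<ge> 8 * ln (card V)"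
  shows "measure_pmf.prob (edge_bits V p) {b. \<not> (\<forall>S T. S \<subseteq> V \<longrightarrow> T \<subseteq> V \<longrightarrow> S \<inter> T = {} \<longrightarrow> card S = card T \<longrightarrow>
      real (card S) \<ge> t0 \<longrightarrow> real (card (between (present V b) S T)) \<ge> q / 2 * (real (card S))\<^sup>2)} \<le> 2 / card V"
proof -
  let ?n = "real (card V)"
  let ?P = "edge_bits V p"
  let ?B = "\<lambda>(S, T). {b. real (card (between (present V b) S T)) < q / 2 * (real (card S))\<^sup>2}"
  let ?K = "{t \<in> {1..card V}. real t \<ge> t0}"
  let ?S = "\<lambda>t. {(S, T) \<in> nsets V t \<times> nsets V t. S \<inter> T = {}}"
  have n: "?n \<ge> 1" using V by (simp add: Suc_le_eq card_gt_0_iff)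
  have fS: "finite (?S t)" for t
    using finite_imp_finite_nsets[OF V(1), of t] by (auto intro: finite_subset[of _ "nsets V t \<times> nsets V t"])
  have single: "measure_pmf.prob ?P (?B ST) \<le> 2 * (1 / ?n ^ (4 * t))"
    if ST: "ST \<in> ?S t" and t: "t \<in> ?K" for ST t
  proof -
    obtain S T where S: "ST = (S, T)" "S \<subseteq> V" "T \<subseteq> V" "card S = t" "card T = t" "S \<inter> T = {}"
      using ST by (auto simp: nsets_def)
    let ?C = "between (nsets V 2) S T"
    have cC: "card ?C = t * t" using card_between_complete[OF S(2,3,6)] S by simp
    have t1: "t \<ge> 1" "real t \<ge> t0" using t by auto
    have C1: "?C \<subseteq> nsets V 2" by (auto simp: between_def)
    have C2: "?C \<noteq> {}"
    proof
      assume "?C = {}"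
      then have "t * t = 0" using cC by (simp only: card.empty)
      then show False using t1 by simp
    qed
    have bI: "between (present V b) S T = present V b \<inter> ?C" for b by (auto simp: between_def)
    have "measure_pmf.prob ?P (?B ST) \<le> 2 * exp (- 2 * (p / 2 * (real t)\<^sup>2)\<^sup>2 / card ?C)"
    proof (rule prob_mono[OF _ edge_concentration[OF V(1) C1 C2]])
      have "q / 2 * (real t)\<^sup>2 \<le> p / 2 * (real t)\<^sup>2" using pq by (intro mult_right_mono) auto
      then show "?B ST \<subseteq> {b. p / 2 * (real t)\<^sup>2 \<le> \<bar>real (card (present V b \<inter> ?C)) - p * real (card ?C)\<bar>}"
        unfolding S(1) cC by (auto simp: bI S(4) power2_eq_square)
    qed (use pq in auto)
    also have "2 * (p / 2 * (real t)\<^sup>2)\<^sup>2 / card ?C = p\<^sup>2 * (real t)\<^sup>2 / 2"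
      unfolding cC using t1 by (simp add: power2_eq_square field_simps)
    then have "- 2 * (p / 2 * (real t)\<^sup>2)\<^sup>2 / card ?C = - (p\<^sup>2 * (real t)\<^sup>2 / 2)" by simp
    also have "2 * exp (- (p\<^sup>2 * (real t)\<^sup>2 / 2)) \<le> 2 * exp (- (real (4 * t) * ln ?n))"
    proof -
      have "8 * ln ?n * t \<le> q\<^sup>2 * t0 * t" using t0 by (intro mult_right_mono) auto
      also have "\<dots> \<le> p\<^sup>2 * t * t" using pq t1 t0 by (intro mult_right_mono mult_mono power_mono) auto
      finally show ?thesis by (simp add: power2_eq_square mult_ac)
    qed
    also have "exp (- (real (4 * t) * ln ?n)) = 1 / ?n ^ (4 * t)"
      using n by (simp only: exp_minus exp_of_nat_mult exp_ln inverse_eq_divide)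
    finally show ?thesis .
  qed
  have level: "measure_pmf.prob ?P (\<Union>ST\<in>?S t. ?B ST) \<le> 2 / ?n\<^sup>2" if t: "t \<in> ?K" for t
  proof -
    have "measure_pmf.prob ?P (\<Union>ST\<in>?S t. ?B ST) \<le> (\<Sum>ST\<in>?S t. 2 * (1 / ?n ^ (4 * t)))"
      by (rule prob_UN_le[OF fS]) (rule single[OF _ t])
    also have "\<dots> = real (card (?S t)) * (2 * (1 / ?n ^ (4 * t)))" by simp
    also have "\<dots> \<le> ?n ^ (2 * t) * (2 * (1 / ?n ^ (4 * t)))"
    proof (rule mult_right_mono)
      have "card (?S t) \<le> card (nsets V t \<times> nsets V t)"
        using finite_imp_finite_nsets[OF V(1), of t] by (intro card_mono) auto
      also have "\<dots> \<le> card V ^ t * card V ^ t"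
        unfolding card_cartesian_product by (intro mult_le_mono card_nsets_le_power V)
      finally have "real (card (?S t)) \<le> real (card V ^ t * card V ^ t)" by (rule of_nat_mono)
      then show "real (card (?S t)) \<le> ?n ^ (2 * t)" by (simp add: mult_2 power_add)
    qed simp
    also have "\<dots> = 2 / ?n ^ (2 * t)"
      using n by (simp add: field_simps flip: power_add)
    also have "\<dots> \<le> 2 / ?n ^ 2"
      using n t by (intro divide_left_mono power_increasing) auto
    finally show ?thesis .
  qed
  have "measure_pmf.prob ?P (\<Union>t\<in>?K. \<Union>ST\<in>?S t. ?B ST) \<le> (\<Sum>t\<in>?K. 2 / ?n\<^sup>2)"
    by (rule prob_UN_le) (use level in auto)
  also have "\<dots> = real (card ?K) * (2 / ?n\<^sup>2)" by simp
  also have "\<dots> \<le> ?n * (2 / ?n\<^sup>2)"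
  proof (rule mult_right_mono)
    have "card ?K \<le> card {1..card V}" by (intro card_mono) auto
    then show "real (card ?K) \<le> ?n" by simp
  qed simp
  also have "\<dots> = 2 / ?n" using n by (simp add: power2_eq_square)
  finally have *: "measure_pmf.prob ?P (\<Union>t\<in>?K. \<Union>ST\<in>?S t. ?B ST) \<le> 2 / ?n" .
  show ?thesis
  proof (rule prob_mono[OF _ *], rule subsetI)
    fix b assume "b \<in> {b. \<not> (\<forall>S T. S \<subseteq> V \<longrightarrow> T \<subseteq> V \<longrightarrow> S \<inter> T = {} \<longrightarrow> card S = card T \<longrightarrow>
      real (card S) \<ge> t0 \<longrightarrow> real (card (between (present V b) S T)) \<ge> q / 2 * (real (card S))\<^sup>2)}"
    then obtain S T where S: "S \<subseteq> V" "T \<subseteq> V" "S \<inter> T = {}" "card S = card T" "real (card S) \<ge> t0"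
      "real (card (between (present V b) S T)) < q / 2 * (real (card S))\<^sup>2"
      by (auto simp: not_le)
    have K: "card S \<in> ?K" using S(1,5) t0(1) V(1) card_mono[OF V(1) S(1)] by (auto simp: Suc_le_eq intro: Nat.gr0I)
    have "(S, T) \<in> ?S (card S)"
      using S finite_subset[OF _ V(1)] by (auto simp: nsets_def)
    moreover have "b \<in> ?B (S, T)" using S(6) by simp
    ultimately have "b \<in> (\<Union>ST\<in>?S (card S). ?B ST)" by (rule UN_I)
    with K show "b \<in> (\<Union>t\<in>?K. \<Union>ST\<in>?S t. ?B ST)" by (rule UN_I)
  qed
qed

text \<open>The block of \<open>(e, z)\<close> consists of the edges from \<open>z\<close> to the
  ends of \<open>e\<close>. Blocks are disjoint because \<open>M\<close> is a matching inside
  \<open>A\<close> and \<open>z\<close> lies outside. Their number is at least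
  \<open>card M * card V / 5\<close>, so the threshold is at most half the mean.\<close>

lemma common_neighbours_concentration:
  fixes V :: "'a set" and q :: real
  assumes V: "finite V" "V \<noteq> {}" and pq: "0 < q" "q \<le> p" "p \<le> 1"
    and A: "A \<subseteq> V" "real (card (V - A)) \<ge> card V / 5"
    and M: "M \<subseteq> nsets A 2" "pairwise disjnt M" "M \<noteq> {}"
  shows "measure_pmf.prob (edge_bits V p) {b. real (card {(e, z). e \<in> M \<and> z \<in> V - A \<and> (\<forall>x\<in>e. {x, z} \<in> present V b)})
      < q\<^sup>2 / 20 * card M * card V} \<le> 2 * exp (- (q ^ 4 * card M * card V / 10))"
proof -
  let ?n = "real (card V)"
  let ?T = "M \<times> (V - A)"
  let ?J = "\<lambda>(e, z). (\<lambda>x. {x, z}) ` e"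
  have n: "?n > 0" using V by (simp add: card_gt_0_iff)
  have fA: "finite A" "finite M" using A V(1) finite_subset finite_edges[OF M(1)] by auto
  have b: "real (card (V - A)) > 0" using A(2) n by simp
  then have VA: "V - A \<noteq> {}" by (metis card.empty of_nat_0 less_irrefl)
  have cM: "real (card M) > 0" using M(3) fA by (simp add: card_gt_0_iff)
  have T: "finite ?T" "?T \<noteq> {}" using fA V VA M(3) by auto
  have cT: "real (card ?T) = real (card M) * real (card (V - A))" by (simp add: card_cartesian_product)
  have M2: "card e = 2" "e \<subseteq> A" if "e \<in> M" for e using that M(1) by (auto simp: nsets_def)
  have Jsub: "?J i \<subseteq> nsets V 2" if iT: "i \<in> ?T" for i
  proof
    obtain e z where i: "i = (e, z)" "e \<in> M" "z \<in> V" "z \<notin> A" using iT by auto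
    fix d assume "d \<in> ?J i"
    then obtain x where x: "d = {x, z}" "x \<in> e" using i by auto
    have "x \<in> A" using M2(2)[OF i(2)] x by auto
    then have "x \<in> V" "z \<in> V" "x \<noteq> z" using A i by auto
    then show "d \<in> nsets V 2" using x by simp
  qed
  have Jcard: "card (?J i) = 2" if i: "i \<in> ?T" for i
  proof -
    have "inj_on (\<lambda>x. {x, snd i}) (fst i)" by (auto simp: inj_on_def doubleton_eq_iff)
    then have "card ((\<lambda>x. {x, snd i}) ` fst i) = card (fst i)" by (rule card_image)
    then show ?thesis using i M2(1)[of "fst i"] by (auto simp: case_prod_beta)
  qed
  have disj: "disjoint_family_on ?J ?T"
  proof (unfold disjoint_family_on_def, intro ballI impI)
    fix i j assume ij: "i \<in> ?T" "j \<in> ?T" "i \<noteq> j"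
    show "?J i \<inter> ?J j = {}"
    proof (rule ccontr)
      assume "?J i \<inter> ?J j \<noteq> {}"
      then obtain x y where xy: "x \<in> fst i" "y \<in> fst j" "{x, snd i} = {y, snd j}"
        by (auto simp: case_prod_beta)
      moreover have "x \<in> A" "y \<in> A" "snd i \<notin> A" "snd j \<notin> A"
        using ij xy M2(2)[of "fst i"] M2(2)[of "fst j"] by auto
      ultimately have "x = y" "snd i = snd j" by (auto simp: doubleton_eq_iff)
      moreover have "fst i = fst j"
      proof (rule ccontr)
        assume "fst i \<noteq> fst j"
        moreover have "fst i \<in> M" "fst j \<in> M" using ij by auto
        ultimately have "disjnt (fst i) (fst j)" using M(2) by (simp add: pairwise_def)
        then show False using xy \<open>x = y\<close> by (auto simp: disjnt_def)
      qed
      ultimately show False using ij(3) by (simp add: prod_eq_iff)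
    qed
  qed
  have set_eq: "{(e, z). e \<in> M \<and> z \<in> V - A \<and> (\<forall>x\<in>e. {x, z} \<in> present V b)} = {i \<in> ?T. \<forall>d\<in>?J i. b d}" for b
  proof (rule set_eqI, rule iffI)
    fix i assume i: "i \<in> {i \<in> ?T. \<forall>d\<in>?J i. b d}"
    then have "?J i \<subseteq> nsets V 2" using Jsub by simp
    then show "i \<in> {(e, z). e \<in> M \<and> z \<in> V - A \<and> (\<forall>x\<in>e. {x, z} \<in> present V b)}"
      using i by (auto simp: case_prod_beta image_subset_iff simp del: doubleton_in_nsets_2)
  qed (auto simp: case_prod_beta)
  let ?\<epsilon> = "p\<^sup>2 / 2 * card ?T"
  have "measure_pmf.prob (edge_bits V p) {b. real (card {i \<in> ?T. \<forall>d\<in>?J i. b d}) < q\<^sup>2 / 20 * card M * card V}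
      \<le> 2 * exp (- 2 * ?\<epsilon>\<^sup>2 / card ?T)"
  proof (rule prob_mono[OF _ block_concentration[OF finite_imp_finite_nsets[OF V(1)] Jsub Jcard T disj]])
    have "q\<^sup>2 \<le> p\<^sup>2" using pq by (intro power_mono) auto
    then have q2: "q\<^sup>2 / 4 \<le> p\<^sup>2 / 2" using zero_le_power2[of p] by linarith
    have "q\<^sup>2 / 20 * card M * ?n \<le> q\<^sup>2 / 20 * card M * (5 * card (V - A))"
      using A(2) by (intro mult_left_mono) auto
    also have "\<dots> = q\<^sup>2 / 4 * card ?T" by (simp add: cT)
    also have "\<dots> \<le> p\<^sup>2 / 2 * card ?T" using q2 by (intro mult_right_mono) auto
    finally have le: "q\<^sup>2 / 20 * card M * ?n \<le> p\<^sup>2 / 2 * card ?T" .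
    show "{b. real (card {i \<in> ?T. \<forall>d\<in>?J i. b d}) < q\<^sup>2 / 20 * card M * card V} \<subseteq>
      {b. ?\<epsilon> \<le> \<bar>real (card {i \<in> ?T. \<forall>e\<in>?J i. b e}) - real (card ?T) * p\<^sup>2\<bar>}"
    proof safe
      fix b assume *: "real (card {i \<in> ?T. \<forall>d\<in>?J i. b d}) < q\<^sup>2 / 20 * card M * card V"
      have "real (card ?T) * p\<^sup>2 = p\<^sup>2 / 2 * card ?T + p\<^sup>2 / 2 * card ?T" by simp
      then show "?\<epsilon> \<le> \<bar>real (card {i \<in> ?T. \<forall>e\<in>?J i. b e}) - real (card ?T) * p\<^sup>2\<bar>"
        using * le by linarith
    qed
  qed (use pq in auto)
  also have "- 2 * ?\<epsilon>\<^sup>2 / card ?T = - (p ^ 4 * (card M * real (card (V - A))) / 2)"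
    using cT cM b by (simp add: power2_eq_square power4_eq_xxxx field_simps)
  also have "2 * exp (- (p ^ 4 * (card M * real (card (V - A))) / 2)) \<le> 2 * exp (- (q ^ 4 * card M * ?n / 10))"
  proof -
    have "q ^ 4 * (card M * (?n / 5)) \<le> p ^ 4 * (card M * real (card (V - A)))"
      using pq A(2) by (intro mult_mono power_mono) auto
    then show ?thesis by (simp add: mult_ac)
  qed
  finally show ?thesis unfolding set_eq .
qed

text \<open>Union bound over at most \<open>2 ^ card V\<close> sets and, for each size
  \<open>k\<close>, at most \<open>card V ^ (2 * k)\<close> matchings. One half of the exponent
  \<open>q ^ 4 * k * card V / 10\<close> pays for the matchings, and the other half is at least
  \<open>card V\<close>, so that its exponential beats the number of sets.\<close>

lemma matching_prob:
  fixes V :: "'a set" and q k0 :: real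
  assumes V: "finite V" "V \<noteq> {}" and pq: "0 < q" "q \<le> p" "p \<le> 1"
    and k0: "q ^ 4 * k0 \<ge> 20" "q ^ 4 * card V \<ge> 40 * ln (card V)"
  shows "measure_pmf.prob (edge_bits V p) {b. \<not> (\<forall>A M. A \<subseteq> V \<longrightarrow> real (card (V - A)) \<ge> card V / 5 \<longrightarrow>
      M \<subseteq> nsets A 2 \<longrightarrow> pairwise disjnt M \<longrightarrow> real (card M) \<ge> k0 \<longrightarrow>
      real (card {(e, z). e \<in> M \<and> z \<in> V - A \<and> (\<forall>x\<in>e. {x, z} \<in> present V b)}) \<ge> q\<^sup>2 / 20 * card M * card V)}
    \<le> 2 * (real (card V))\<^sup>2 * 2 ^ card V * exp (- real (card V))"
proof -
  let ?n = "real (card V)"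
  let ?P = "edge_bits V p"
  let ?B = "\<lambda>(A, M). {b. real (card {(e, z). e \<in> M \<and> z \<in> V - A \<and> (\<forall>x\<in>e. {x, z} \<in> present V b)})
      < q\<^sup>2 / 20 * card M * card V}"
  let ?K = "{k \<in> {1..(card V)\<^sup>2}. real k \<ge> k0}"
  let ?S = "\<lambda>k. {(A, M) \<in> Pow V \<times> nsets (nsets V 2) k. real (card (V - A)) \<ge> card V / 5 \<and>
      M \<subseteq> nsets A 2 \<and> pairwise disjnt M}"
  have n: "?n \<ge> 1" using V by (simp add: Suc_le_eq card_gt_0_iff)
  have k0p: "k0 > 0"
  proof (rule ccontr)
    assume "\<not> k0 > 0"
    then have "q ^ 4 * k0 \<le> 0" using pq by (intro mult_nonneg_nonpos) auto
    then show False using k0(1) by simp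
  qed
  have fin: "finite (nsets V 2)" "finite (nsets (nsets V 2) k)" for k
    by (intro finite_imp_finite_nsets V(1))+
  have fS: "finite (?S k)" for k
    by (rule finite_subset[of _ "Pow V \<times> nsets (nsets V 2) k"]) (use fin(2)[of k] V(1) in auto)
  have single: "measure_pmf.prob ?P (?B AM) \<le> 2 * (1 / ?n ^ (2 * k)) * exp (- ?n)"
    if AM: "AM \<in> ?S k" and k: "k \<in> ?K" for AM k
  proof -
    obtain A M where A1: "AM = (A, M)" by (cases AM)
    have A: "A \<subseteq> V" "real (card (V - A)) \<ge> card V / 5" "M \<subseteq> nsets A 2" "pairwise disjnt M"
      and Mk: "M \<in> nsets (nsets V 2) k"
      using AM unfolding A1 mem_Collect_eq case_prod_conv mem_Times_iff fst_conv snd_conv Pow_iff by blast+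
    have cM: "card M = k" using Mk by (simp add: nsets_def)
    have "M \<noteq> {}" using cM k by auto
    from common_neighbours_concentration[OF V pq A this]
    have "measure_pmf.prob ?P (?B AM) \<le> 2 * exp (- (q ^ 4 * k * ?n / 10))"
      unfolding A1 cM case_prod_conv .
    also have "\<dots> \<le> 2 * exp (- (real (2 * k) * ln ?n) + - ?n)"
    proof -
      have "40 * ln ?n * k \<le> q ^ 4 * ?n * k" using k0(2) by (intro mult_right_mono) auto
      moreover have "20 * ?n \<le> q ^ 4 * k0 * ?n" using k0(1) by (intro mult_right_mono) auto
      moreover have "q ^ 4 * k0 * ?n \<le> q ^ 4 * k * ?n" using k pq by (intro mult_right_mono mult_left_mono) auto
      ultimately show ?thesis by (simp add: mult_ac)
    qed
    also have "exp (- (real (2 * k) * ln ?n) + - ?n) = (1 / ?n ^ (2 * k)) * exp (- ?n)"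
      using n by (simp only: exp_add exp_minus exp_of_nat_mult exp_ln inverse_eq_divide)
    finally show ?thesis by simp
  qed
  have level: "measure_pmf.prob ?P (\<Union>AM\<in>?S k. ?B AM) \<le> 2 * 2 ^ card V * exp (- ?n)" if k: "k \<in> ?K" for k
  proof -
    have "measure_pmf.prob ?P (\<Union>AM\<in>?S k. ?B AM) \<le> (\<Sum>AM\<in>?S k. 2 * (1 / ?n ^ (2 * k)) * exp (- ?n))"
      by (rule prob_UN_le[OF fS]) (rule single[OF _ k])
    also have "\<dots> = real (card (?S k)) * (2 * (1 / ?n ^ (2 * k)) * exp (- ?n))" by simp
    also have "\<dots> \<le> (2 ^ card V * ?n ^ (2 * k)) * (2 * (1 / ?n ^ (2 * k)) * exp (- ?n))"
    proof (rule mult_right_mono)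
      have "card (?S k) \<le> card (Pow V \<times> nsets (nsets V 2) k)"
        using fin(2)[of k] V(1) by (intro card_mono) auto
      also have "\<dots> \<le> 2 ^ card V * ((card V)\<^sup>2) ^ k"
        unfolding card_cartesian_product card_Pow[OF V(1)]
        using card_nsets_le_power[OF fin(1), of k] power_mono[OF card_nsets_le_power[OF V(1), of 2], of k]
        by (intro mult_le_mono2) auto
      finally have "real (card (?S k)) \<le> real (2 ^ card V * ((card V)\<^sup>2) ^ k)" by (rule of_nat_mono)
      then show "real (card (?S k)) \<le> 2 ^ card V * ?n ^ (2 * k)" by (simp add: power_mult)
    qed simp
    also have "\<dots> = 2 * 2 ^ card V * exp (- ?n)"
      using n by simp
    finally show ?thesis .
  qed
  have "measure_pmf.prob ?P (\<Union>k\<in>?K. \<Union>AM\<in>?S k. ?B AM) \<le> (\<Sum>k\<in>?K. 2 * 2 ^ card V * exp (- ?n))"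
    by (rule prob_UN_le) (use level in auto)
  also have "\<dots> = real (card ?K) * (2 * 2 ^ card V * exp (- ?n))" by simp
  also have "\<dots> \<le> ?n\<^sup>2 * (2 * 2 ^ card V * exp (- ?n))"
  proof (rule mult_right_mono)
    have "card ?K \<le> card {1..(card V)\<^sup>2}" by (intro card_mono) auto
    then show "real (card ?K) \<le> ?n\<^sup>2" by (simp only: card_atLeastAtMost flip: of_nat_power)
  qed simp
  finally have *: "measure_pmf.prob ?P (\<Union>k\<in>?K. \<Union>AM\<in>?S k. ?B AM) \<le> 2 * ?n\<^sup>2 * 2 ^ card V * exp (- ?n)"
    by (simp add: mult_ac)
  show ?thesis
  proof (rule prob_mono[OF _ *], rule subsetI)
    fix b assume "b \<in> {b. \<not> (\<forall>A M. A \<subseteq> V \<longrightarrow> real (card (V - A)) \<ge> card V / 5 \<longrightarrow>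
      M \<subseteq> nsets A 2 \<longrightarrow> pairwise disjnt M \<longrightarrow> real (card M) \<ge> k0 \<longrightarrow>
      real (card {(e, z). e \<in> M \<and> z \<in> V - A \<and> (\<forall>x\<in>e. {x, z} \<in> present V b)}) \<ge> q\<^sup>2 / 20 * card M * card V)}"
    then obtain A M where A: "A \<subseteq> V" "real (card (V - A)) \<ge> card V / 5"
      "M \<subseteq> nsets A 2" "pairwise disjnt M" "real (card M) \<ge> k0" "b \<in> ?B (A, M)"
      by (auto simp: not_le)
    have MV: "M \<subseteq> nsets V 2" using A(1,3) nsets_mono[OF A(1), of 2] by blast
    have "card M \<le> card (nsets V 2)" using card_mono[OF fin(1) MV] .
    also have "\<dots> \<le> (card V)\<^sup>2" using card_nsets_le_power[OF V(1)] .
    finally have K: "card M \<in> ?K" using A(5) k0p by (auto simp: Suc_le_eq intro: Nat.gr0I)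
    have "(A, M) \<in> ?S (card M)"
      using A MV finite_subset[OF MV fin(1)] by (auto simp: nsets_def[of _ "card M"])
    then have "b \<in> (\<Union>AM\<in>?S (card M). ?B AM)" using A(6) by (rule UN_I)
    with K show "b \<in> (\<Union>k\<in>?K. \<Union>AM\<in>?S k. ?B AM)" by (rule UN_I)
  qed
qed

lemma vertex_concentration:
  fixes V :: "'a set" and J :: "'a \<Rightarrow> 'a set set" and p \<delta> :: real
  assumes V: "finite V" and W: "W \<subseteq> V" "W \<noteq> {}" and p: "0 \<le> p" "p \<le> 1" and \<delta>: "\<delta> \<ge> 0"
    and J: "\<And>v. v \<in> W \<Longrightarrow> J v \<subseteq> nsets V 2" "\<And>v. v \<in> W \<Longrightarrow> card (J v) = s" "disjoint_family_on J W"
  shows "measure_pmf.prob (edge_bits V p)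
     {b. \<bar>real (card {v \<in> W. \<forall>e\<in>J v. b e}) - real (card W) * p ^ s\<bar> \<ge> \<delta> * card W} \<le> 2 * exp (- 2 * \<delta>\<^sup>2 * card W)"
proof -
  have fW: "finite W" using V W finite_subset by blast
  then have "real (card W) > 0" using W by (simp add: card_gt_0_iff)
  then have "- 2 * (\<delta> * card W)\<^sup>2 / card W = - 2 * \<delta>\<^sup>2 * card W"
    by (simp add: power2_eq_square)
  moreover have "0 \<le> \<delta> * card W" using \<delta> by simp
  ultimately show ?thesis
    using block_concentration[OF finite_imp_finite_nsets[OF V] J(1) J(2) fW W(2) J(3) p, of "\<delta> * card W"] by simp
qed

text \<open>The degrees of \<open>x\<close> and \<open>y\<close> cancel up to errors, so the gap is
  about the number of common neighbours. By \<open>best_cut_detach_degree\<close> it forces many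
  neighbours of \<open>y\<close> to lie across the best cut.\<close>

lemma degree_gap_prob:
  fixes V :: "'a set" and q :: real
  assumes V: "finite V" "card V \<ge> 4" and pq: "0 < q" "q \<le> p" "p \<le> 1" and xy: "x \<in> V" "y \<in> V" "x \<noteq> y"
  shows "measure_pmf.prob (edge_bits V p) {b. real (card (nbh (present V b) y - {x})) <
       q\<^sup>2 / 4 * card V + real (card (nbh (present V b) x - nbh (present V b) y - {y}))}
     \<le> 6 * exp (- (q ^ 4 * card V / 36))"
proof -
  let ?n = "real (card V)"
  let ?P = "edge_bits V p"
  define W where "W = V - {x, y}"
  \<comment> \<open>Three counts with this error cost \<open>q\<^sup>2 * card W / 2\<close>, half of
    the lower bound for the gap. The other half is at least
    \<open>q\<^sup>2 / 4 * card V\<close>.\<close>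
  define \<delta> where "\<delta> = q\<^sup>2 / 6"
  have cW: "card W = card V - 2" using V xy by (simp add: W_def card_Diff_subset)
  have m: "real (card W) = ?n - 2" "real (card W) \<ge> ?n / 2" using V cW by auto
  have fW: "finite W" using V by (simp add: W_def)
  have W: "W \<subseteq> V" by (auto simp: W_def)
  have "W \<noteq> {}" using cW V(2) by (intro notI) simp
  note W = W this
  have p: "0 \<le> p" "p \<le> 1" and \<delta>: "\<delta> \<ge> 0" using pq by (auto simp: \<delta>_def)
  have disj: "disjoint_family_on (\<lambda>v. {{z, v}}) W" for z
    by (auto simp: disjoint_family_on_def doubleton_eq_iff)
  let ?X = "{b. \<bar>real (card {v \<in> W. \<forall>e\<in>{{x, v}}. b e}) - real (card W) * p ^ 1\<bar> \<ge> \<delta> * card W}"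
  let ?Y = "{b. \<bar>real (card {v \<in> W. \<forall>e\<in>{{y, v}}. b e}) - real (card W) * p ^ 1\<bar> \<ge> \<delta> * card W}"
  let ?Z = "{b. \<bar>real (card {v \<in> W. \<forall>e\<in>{{x, v}, {y, v}}. b e}) - real (card W) * p ^ 2\<bar> \<ge> \<delta> * card W}"
  let ?e = "2 * exp (- 2 * \<delta>\<^sup>2 * card W)"
  have X: "measure_pmf.prob ?P ?X \<le> ?e"
    by (rule vertex_concentration[OF V(1) W p \<delta> _ _ disj]) (use xy in \<open>auto simp: W_def\<close>)
  have Y: "measure_pmf.prob ?P ?Y \<le> ?e"
    by (rule vertex_concentration[OF V(1) W p \<delta> _ _ disj]) (use xy in \<open>auto simp: W_def\<close>)
  have Z: "measure_pmf.prob ?P ?Z \<le> ?e"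
    by (rule vertex_concentration[OF V(1) W p \<delta>])
      (use xy in \<open>auto simp: W_def disjoint_family_on_def doubleton_eq_iff card_2_iff\<close>)
  have "measure_pmf.prob ?P (?X \<union> (?Y \<union> ?Z)) \<le> measure_pmf.prob ?P ?X + measure_pmf.prob ?P (?Y \<union> ?Z)"
    by (rule measure_Un_le) auto
  also have "measure_pmf.prob ?P (?Y \<union> ?Z) \<le> measure_pmf.prob ?P ?Y + measure_pmf.prob ?P ?Z"
    by (rule measure_Un_le) auto
  finally have "measure_pmf.prob ?P (?X \<union> (?Y \<union> ?Z)) \<le> 6 * exp (- 2 * \<delta>\<^sup>2 * card W)"
    using X Y Z by linarith
  also have "\<dots> \<le> 6 * exp (- (q ^ 4 * ?n / 36))"
  proof -
    have "q ^ 4 / 18 * (?n / 2) \<le> q ^ 4 / 18 * card W" using m by (intro mult_left_mono) auto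
    moreover have "- 2 * \<delta>\<^sup>2 * card W = - (q ^ 4 / 18 * card W)"
      by (simp add: \<delta>_def power2_eq_square power4_eq_xxxx)
    ultimately have "- 2 * \<delta>\<^sup>2 * card W \<le> - (q ^ 4 * ?n / 36)" by linarith
    then show ?thesis by simp
  qed
  finally have *: "measure_pmf.prob ?P (?X \<union> (?Y \<union> ?Z)) \<le> 6 * exp (- (q ^ 4 * ?n / 36))" .
  show ?thesis
  proof (rule prob_mono[OF _ *], rule subsetI, rule ccontr)
    fix b
    assume b: "b \<in> {b. real (card (nbh (present V b) y - {x})) <
       q\<^sup>2 / 4 * card V + real (card (nbh (present V b) x - nbh (present V b) y - {y}))}"
      and nb: "b \<notin> ?X \<union> (?Y \<union> ?Z)"
    have iff: "{z, v} \<in> present V b \<longleftrightarrow> z \<in> V \<and> v \<in> V \<and> z \<noteq> v \<and> b {z, v}" for z v by auto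
    have 1: "nbh (present V b) y - {x} = {v \<in> W. \<forall>e\<in>{{y, v}}. b e}"
      unfolding nbh_def iff using xy by (auto simp: W_def)
    have 2: "nbh (present V b) x - nbh (present V b) y - {y} = {v \<in> W. \<forall>e\<in>{{x, v}}. b e} - {v \<in> W. \<forall>e\<in>{{x, v}, {y, v}}. b e}"
      unfolding nbh_def iff using xy by (auto simp: W_def)
    have "card ({v \<in> W. \<forall>e\<in>{{x, v}}. b e} - {v \<in> W. \<forall>e\<in>{{x, v}, {y, v}}. b e}) =
      card {v \<in> W. \<forall>e\<in>{{x, v}}. b e} - card {v \<in> W. \<forall>e\<in>{{x, v}, {y, v}}. b e}"
      using fW by (intro card_Diff_subset) auto
    moreover have "card {v \<in> W. \<forall>e\<in>{{x, v}, {y, v}}. b e} \<le> card {v \<in> W. \<forall>e\<in>{{x, v}}. b e}"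
      using fW by (intro card_mono) auto
    ultimately have 3: "real (card (nbh (present V b) x - nbh (present V b) y - {y})) =
      real (card {v \<in> W. \<forall>e\<in>{{x, v}}. b e}) - real (card {v \<in> W. \<forall>e\<in>{{x, v}, {y, v}}. b e})"
      unfolding 2 by (simp only: of_nat_diff)
    have "real (card W) * q\<^sup>2 \<le> real (card W) * p\<^sup>2" using pq by (intro mult_left_mono power_mono) auto
    moreover have "3 * (\<delta> * card W) = real (card W) * q\<^sup>2 / 2" by (simp add: \<delta>_def)
    moreover have "q\<^sup>2 / 4 * ?n \<le> real (card W) * q\<^sup>2 / 2"
      using mult_left_mono[OF m(2), of "q\<^sup>2 / 2"] by (simp add: mult_ac)
    ultimately have gap: False if "\<bar>dx - real (card W) * p ^ 1\<bar> < \<delta> * card W"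
      "\<bar>dy - real (card W) * p ^ 1\<bar> < \<delta> * card W" "\<bar>dz - real (card W) * p\<^sup>2\<bar> < \<delta> * card W"
      "dy < q\<^sup>2 / 4 * ?n + (dx - dz)" for dx dy dz
      using that by (simp only: abs_less_iff power_one_right) linarith
    show False
      by (rule gap[OF _ _ _ b[unfolded mem_Collect_eq 3, unfolded 1]])
        (use nb in \<open>simp_all only: Un_iff mem_Collect_eq de_Morgan_disj not_le\<close>)
  qed
qed

text \<open>
  The edges are exposed in three stages: those not joining \<open>x\<close> to \<open>V - {x, y}\<close>, which determine the
  neighbours \<open>Y\<close> of \<open>y\<close>; those from \<open>x\<close> to vertices outside \<open>Y\<close>, which then determine \<open>best_cut\<close>; and
  those from \<open>x\<close> to \<open>Y\<close>.
\<close>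

lemma best_cut_codegree_prob:
  fixes V :: "'a set" and q :: real
  assumes V: "finite V" "V \<noteq> {}" and pq: "0 < q" "q \<le> p" "p \<le> 1" and xy: "x \<in> V" "y \<in> V" "x \<noteq> y"
  shows "measure_pmf.prob (edge_bits V p) {b. real (card (nbh (present V b) y - {x})) \<ge>
       q\<^sup>2 / 4 * card V + real (card (nbh (present V b) x - nbh (present V b) y - {y})) \<and>
       real (card (nbh (present V b) x \<inter> nbh (present V b) y - best_cut V (detach (present V b) x y) x y)) < q ^ 3 * card V / 16}
     \<le> 2 * exp (- (q ^ 4 * card V / 16))"
    (is "measure_pmf.prob _ ?Bad \<le> ?\<epsilon>")
proof -
  let ?n = "real (card V)"
  \<comment> \<open>\<open>R2\<close> is exposed first. \<open>R1\<close> is split below into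
    \<open>RN\<close> and \<open>RY\<close>, the second and the third stage.\<close>
  define R1 where "R1 = (\<lambda>v. {x, v}) ` (V - {x, y})"
  define R2 where "R2 = nsets V 2 - R1"
  have n: "?n > 0" using V by (simp add: card_gt_0_iff)
  have R1: "R1 \<subseteq> nsets V 2" using xy by (auto simp: R1_def)
  have I: "nsets V 2 = R2 \<union> R1" using R1 by (auto simp: R2_def)
  have fin: "finite R2" "finite R1" "R2 \<inter> R1 = {}"
    using finite_imp_finite_nsets[OF V(1), of 2] finite_subset[OF R1] by (auto simp: R2_def)
  have \<epsilon>: "?\<epsilon> \<ge> 0" by simp
  have "measure_pmf.prob (Pi_pmf (R2 \<union> R1) False (\<lambda>_. bernoulli_pmf p)) ?Bad \<le> ?\<epsilon>"
  proof (rule prob_Pi_pmf_Un_le[OF fin \<epsilon>])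
    fix f :: "'a set \<Rightarrow> bool"
    define Y where "Y = {v \<in> V - {x, y}. f {y, v}}"
    define RY where "RY = (\<lambda>v. {x, v}) ` Y"
    define RN where "RN = R1 - RY"
    have RY: "RY \<subseteq> R1" by (auto simp: RY_def R1_def Y_def)
    have I1: "R1 = RN \<union> RY" using RY by (auto simp: RN_def)
    have fin1: "finite RN" "finite RY" "RN \<inter> RY = {}"
      using fin(2) finite_subset[OF RY] by (auto simp: RN_def)
    have fY: "finite Y" using V by (simp add: Y_def)
    show "measure_pmf.prob (Pi_pmf R1 False (\<lambda>_. bernoulli_pmf p)) {g. (\<lambda>e. if e \<in> R2 then f e else g e) \<in> ?Bad} \<le> ?\<epsilon>"
      unfolding I1
    proof (rule prob_Pi_pmf_Un_le[OF fin1 \<epsilon>])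
      fix g :: "'a set \<Rightarrow> bool"
      \<comment> \<open>The detached graph, written without the third-stage bits \<open>h\<close>.
        Hence \<open>A\<close> and \<open>T\<close> are fixed before these are exposed.\<close>
      define D where "D = {e \<in> nsets V 2. e \<noteq> {x, y} \<and> (if e \<in> R2 then f e else e \<in> RN \<and> g e)}"
      define A where "A = best_cut V D x y"
      define T where "T = Y - A"
      define b where "b = (\<lambda>h e. if e \<in> R2 then f e else if e \<in> RN then g e else h e)"
      have xA: "x \<in> A" using best_cut[OF V(1) xy(1,2)] by (simp add: A_def)
      have yR2: "{y, v} \<in> R2" if "v \<in> V" "v \<noteq> x" "v \<noteq> y" for v
        using that xy by (auto simp: R2_def R1_def doubleton_eq_iff)
      have Ny: "nbh (present V (b h)) y - {x} = Y" for h
      proof (rule set_eqI)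
        fix v
        show "v \<in> nbh (present V (b h)) y - {x} \<longleftrightarrow> v \<in> Y"
        proof (cases "v \<in> V - {x, y}")
          case True
          then have "b h {y, v} = f {y, v}" using yR2[of v] by (simp add: b_def)
          then show ?thesis using True xy by (auto simp: nbh_iff Y_def)
        qed (auto simp: nbh_iff Y_def)
      qed
      have RY_b: "b h e = h e" if "e \<in> RY" for h e
        using that RY fin(3) fin1(3) by (auto simp: b_def)
      have D: "detach (present V (b h)) x y = D" for h
      proof -
        have 1: "(\<forall>v\<in>nbh (present V (b h)) y. e \<noteq> {x, v}) \<longleftrightarrow> e \<notin> RY" if e: "e \<in> nsets V 2" for e
        proof -
          have "e \<noteq> {x, x}" using e by (auto simp: nsets_def)
          then have "(\<forall>v\<in>nbh (present V (b h)) y. e \<noteq> {x, v}) \<longleftrightarrow> (\<forall>v\<in>nbh (present V (b h)) y - {x}. e \<noteq> {x, v})"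
            by blast
          then show ?thesis unfolding Ny RY_def by auto
        qed
        show ?thesis
        proof (rule set_eqI)
          fix e
          show "e \<in> detach (present V (b h)) x y \<longleftrightarrow> e \<in> D"
          proof (cases "e \<in> nsets V 2")
            case True
            have "e \<in> R2 \<or> e \<in> RN \<or> e \<in> RY" using True I I1 by blast
            moreover have "e \<in> R2 \<Longrightarrow> e \<notin> RY" "e \<in> RN \<Longrightarrow> e \<notin> RY" "e \<in> RN \<Longrightarrow> e \<notin> R2" "e \<in> RY \<Longrightarrow> e \<notin> R2"
              using fin(3) fin1(3) RY I1 by blast+
            moreover have "b h e = (if e \<in> R2 then f e else if e \<in> RN then g e else h e)"
              by (simp add: b_def)
            ultimately show ?thesis
              unfolding detach_def D_def mem_Collect_eq 1[OF True] using True by (auto split: if_splits)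
          qed (simp add: detach_def D_def)
        qed
      qed
      have codeg: "nbh (present V (b h)) x \<inter> nbh (present V (b h)) y - A = {v \<in> T. \<forall>e\<in>{{x, v}}. h e}" for h
      proof -
        have "nbh (present V (b h)) x \<inter> nbh (present V (b h)) y - A = {v \<in> T. {x, v} \<in> present V (b h)}"
        proof -
          have "nbh E x \<inter> nbh E y - A = {v \<in> nbh E y - {x} - A. {x, v} \<in> E}" for E
            using xA by (auto simp: nbh_iff)
          then show ?thesis unfolding T_def Ny[of h, symmetric] .
        qed
        also have "\<dots> = {v \<in> T. \<forall>e\<in>{{x, v}}. h e}"
          using RY_b xy by (auto simp: T_def RY_def Y_def)
        finally show ?thesis .
      qed
      have step: "card Y \<le> 2 * card T + card (nbh (present V (b h)) x - nbh (present V (b h)) y - {y})" for h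
      proof -
        have "present V (b h) \<subseteq> nsets V 2" by auto
        from best_cut_detach_degree[OF this V(1) xy]
        have "card Y \<le> 2 * card (nbh (present V (b h)) y - A) + card (nbh (present V (b h)) x - nbh (present V (b h)) y - {y})"
          unfolding D Ny A_def .
        moreover have "nbh (present V (b h)) y - A = T" using Ny[of h] xA unfolding T_def by blast
        ultimately show ?thesis by simp
      qed
      show "measure_pmf.prob (Pi_pmf RY False (\<lambda>_. bernoulli_pmf p))
          {h. (\<lambda>e. if e \<in> RN then g e else h e) \<in> {g. (\<lambda>e. if e \<in> R2 then f e else g e) \<in> ?Bad}} \<le> ?\<epsilon>"
      proof (cases "real (card T) \<ge> q\<^sup>2 / 8 * ?n")
        case True
        have cT: "real (card T) > 0" using True n pq by (smt (verit) mult_pos_pos zero_less_power divide_pos_pos)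
        then have "T \<noteq> {}" by (intro notI) simp
        moreover have "finite T" using fY by (simp add: T_def)
        ultimately have T: "finite T" "T \<noteq> {}" by simp_all
        have TY: "T \<subseteq> Y" by (auto simp: T_def)
        \<comment> \<open>Half the mean number of edges from \<open>x\<close> to \<open>T\<close>,
          and at least \<open>q / 2 * (q\<^sup>2 / 8 * ?n) = q ^ 3 * ?n / 16\<close>.\<close>
        let ?d = "p / 2 * card T"
        have "measure_pmf.prob (Pi_pmf RY False (\<lambda>_. bernoulli_pmf p))
          {h. (\<lambda>e. if e \<in> RN then g e else h e) \<in> {g. (\<lambda>e. if e \<in> R2 then f e else g e) \<in> ?Bad}}
          \<le> 2 * exp (- 2 * ?d\<^sup>2 / card T)"
        proof (rule prob_mono[OF _ block_concentration[OF fin1(2), of T "\<lambda>v. {{x, v}}" 1]])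
          show "{h. (\<lambda>e. if e \<in> RN then g e else h e) \<in> {g. (\<lambda>e. if e \<in> R2 then f e else g e) \<in> ?Bad}} \<subseteq>
            {b. ?d \<le> \<bar>real (card {i \<in> T. \<forall>e\<in>{{x, i}}. b e}) - real (card T) * p ^ 1\<bar>}"
          proof (rule subsetI)
            fix h assume h: "h \<in> {h. (\<lambda>e. if e \<in> RN then g e else h e) \<in> {g. (\<lambda>e. if e \<in> R2 then f e else g e) \<in> ?Bad}}"
            have "b h \<in> ?Bad" using CollectD[OF CollectD[OF h]] unfolding b_def .
            then have "real (card {v \<in> T. \<forall>e\<in>{{x, v}}. h e}) < q ^ 3 * ?n / 16"
              unfolding mem_Collect_eq D A_def[symmetric] codeg by blast
            moreover have "q / 2 * (q\<^sup>2 / 8 * ?n) \<le> p / 2 * card T"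
              using True pq n by (intro mult_mono) auto
            moreover have "q / 2 * (q\<^sup>2 / 8 * ?n) = q ^ 3 * ?n / 16"
              by (simp add: power2_eq_square power3_eq_cube)
            moreover have "real (card T) * p ^ 1 = p / 2 * card T + p / 2 * card T" by simp
            ultimately have "?d \<le> \<bar>real (card {i \<in> T. \<forall>e\<in>{{x, i}}. h e}) - real (card T) * p ^ 1\<bar>"
              by linarith
            then show "h \<in> {b. ?d \<le> \<bar>real (card {i \<in> T. \<forall>e\<in>{{x, i}}. b e}) - real (card T) * p ^ 1\<bar>}"
              by (simp only: mem_Collect_eq)
          qed
        qed (use T TY pq in \<open>auto simp: RY_def disjoint_family_on_def doubleton_eq_iff\<close>)
        also have "- 2 * ?d\<^sup>2 / card T = - (p\<^sup>2 * card T / 2)"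
          using cT by (simp add: power2_eq_square)
        also have "2 * exp (- (p\<^sup>2 * card T / 2)) \<le> ?\<epsilon>"
        proof -
          have "q\<^sup>2 * (q\<^sup>2 / 8 * ?n) \<le> p\<^sup>2 * card T"
            using True pq n by (intro mult_mono power_mono) auto
          moreover have "q\<^sup>2 * (q\<^sup>2 / 8 * ?n) = q ^ 4 * ?n / 8" by (simp add: power2_eq_square power4_eq_xxxx)
          ultimately have "q ^ 4 * ?n / 16 \<le> p\<^sup>2 * card T / 2" by linarith
          then show ?thesis by simp
        qed
        finally show ?thesis .
      next
        case False
        \<comment> \<open>For small \<open>T\<close> the degree gap contradicts \<open>step\<close>,
          so the event is empty whatever the third stage gives.\<close>
        have "b h \<notin> ?Bad" for h
        proof
          assume "b h \<in> ?Bad"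
          then have "real (card Y) \<ge> q\<^sup>2 / 4 * ?n + real (card (nbh (present V (b h)) x - nbh (present V (b h)) y - {y}))"
            unfolding mem_Collect_eq Ny by blast
          moreover have "real (card Y) \<le> 2 * real (card T) + real (card (nbh (present V (b h)) x - nbh (present V (b h)) y - {y}))"
            using of_nat_mono[OF step[of h], where 'a = real] by simp
          moreover have "2 * (q\<^sup>2 / 8 * ?n) = q\<^sup>2 / 4 * ?n" by simp
          ultimately show False using False by linarith
        qed
        then have "{h. (\<lambda>e. if e \<in> RN then g e else h e) \<in> {g. (\<lambda>e. if e \<in> R2 then f e else g e) \<in> ?Bad}} = {}"
          unfolding b_def by blast
        then show ?thesis by (simp only: measure_empty \<epsilon>)
      qed
    qed
  qed
  then show ?thesis by (simp only: I[symmetric])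
qed

text \<open>The union bound runs only over pairs \<open>x\<close>, \<open>y\<close>:
  \<open>defect_from_best_cut\<close> compares every \<open>A\<close> with the same best cut.
  \<open>\<zeta>\<close> is half of \<open>q ^ 3 * card V / 16\<close> because that comparison asks
  for \<open>2 * \<zeta>\<close>.\<close>

lemma defect_prob:
  fixes V :: "'a set" and q :: real
  assumes V: "finite V" "card V \<ge> 4" and pq: "0 < q" "q \<le> p" "p \<le> 1"
  defines "\<zeta> \<equiv> q ^ 3 * card V / 32"
  shows "measure_pmf.prob (edge_bits V p) {b. \<not> (\<forall>A x y. A \<subseteq> V \<longrightarrow> x \<in> A \<longrightarrow> y \<in> A \<longrightarrow> x \<noteq> y \<longrightarrow>
      real (card (nbh (present V b) x \<inter> nbh (present V b) y - A)) < \<zeta> \<longrightarrow>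
      (\<exists>X\<subseteq>V. real (card (cut (present V b) X)) \<ge> real (card (cut (present V b) A)) + \<zeta>))}
    \<le> (real (card V))\<^sup>2 * (8 * exp (- (q ^ 4 * card V / 36)))"
proof -
  let ?n = "real (card V)"
  let ?P = "edge_bits V p"
  let ?S = "{(x, y) \<in> V \<times> V. x \<noteq> y}"
  let ?B1 = "\<lambda>(x, y). {b. real (card (nbh (present V b) y - {x})) <
       q\<^sup>2 / 4 * card V + real (card (nbh (present V b) x - nbh (present V b) y - {y}))}"
  let ?B2 = "\<lambda>(x, y). {b. real (card (nbh (present V b) y - {x})) \<ge>
       q\<^sup>2 / 4 * card V + real (card (nbh (present V b) x - nbh (present V b) y - {y})) \<and>
       real (card (nbh (present V b) x \<inter> nbh (present V b) y - best_cut V (detach (present V b) x y) x y)) < q ^ 3 * card V / 16}"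
  have V0: "V \<noteq> {}" using V by auto
  have fS: "finite ?S" using V by (auto intro: finite_subset[of _ "V \<times> V"])
  have "measure_pmf.prob ?P (?B1 xy \<union> ?B2 xy) \<le> 8 * exp (- (q ^ 4 * ?n / 36))" if S: "xy \<in> ?S" for xy
  proof -
    obtain x y where xy: "xy = (x, y)" by (cases xy)
    have xyV: "x \<in> V" "y \<in> V" "x \<noteq> y" using S unfolding xy by auto
    have "measure_pmf.prob ?P (?B1 xy \<union> ?B2 xy) \<le> measure_pmf.prob ?P (?B1 xy) + measure_pmf.prob ?P (?B2 xy)"
      by (rule measure_Un_le) auto
    also have "\<dots> \<le> 6 * exp (- (q ^ 4 * ?n / 36)) + 2 * exp (- (q ^ 4 * ?n / 16))"
      unfolding xy case_prod_conv
      by (intro add_mono degree_gap_prob[OF V pq xyV] best_cut_codegree_prob[OF V(1) V0 pq xyV])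
    also have "\<dots> \<le> 8 * exp (- (q ^ 4 * ?n / 36))"
      using pq by simp
    finally show ?thesis .
  qed
  from prob_UN_le[OF fS this]
  have "measure_pmf.prob ?P (\<Union>xy\<in>?S. ?B1 xy \<union> ?B2 xy) \<le> real (card ?S) * (8 * exp (- (q ^ 4 * ?n / 36)))" by simp
  also have "\<dots> \<le> ?n\<^sup>2 * (8 * exp (- (q ^ 4 * ?n / 36)))"
  proof (rule mult_right_mono)
    have "card ?S \<le> card (V \<times> V)" using V by (intro card_mono) auto
    then have "real (card ?S) \<le> real (card V * card V)" unfolding card_cartesian_product by (rule of_nat_mono)
    then show "real (card ?S) \<le> ?n\<^sup>2" by (simp add: power2_eq_square)
  qed simp
  finally have *: "measure_pmf.prob ?P (\<Union>xy\<in>?S. ?B1 xy \<union> ?B2 xy) \<le> ?n\<^sup>2 * (8 * exp (- (q ^ 4 * ?n / 36)))" .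
  show ?thesis
  proof (rule prob_mono[OF _ *], rule subsetI, rule ccontr)
    fix b
    assume "b \<in> {b. \<not> (\<forall>A x y. A \<subseteq> V \<longrightarrow> x \<in> A \<longrightarrow> y \<in> A \<longrightarrow> x \<noteq> y \<longrightarrow>
      real (card (nbh (present V b) x \<inter> nbh (present V b) y - A)) < \<zeta> \<longrightarrow>
      (\<exists>X\<subseteq>V. real (card (cut (present V b) X)) \<ge> real (card (cut (present V b) A)) + \<zeta>))}"
      and nb: "b \<notin> (\<Union>xy\<in>?S. ?B1 xy \<union> ?B2 xy)"
    then obtain A x y where A: "A \<subseteq> V" "x \<in> A" "y \<in> A" "x \<noteq> y"
      "real (card (nbh (present V b) x \<inter> nbh (present V b) y - A)) < \<zeta>"
      and no: "\<not> (\<exists>X\<subseteq>V. real (card (cut (present V b) X)) \<ge> real (card (cut (present V b) A)) + \<zeta>)"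
      unfolding mem_Collect_eq not_all not_imp by (elim exE conjE)
    have E: "present V b \<subseteq> nsets V 2" by auto
    have "(x, y) \<in> ?S" using A by auto
    then have nb2: "b \<notin> ?B1 (x, y) \<union> ?B2 (x, y)" using nb by (meson UN_I)
    then have "\<not> real (card (nbh (present V b) y - {x})) <
       q\<^sup>2 / 4 * card V + real (card (nbh (present V b) x - nbh (present V b) y - {y}))" by simp
    then have "\<not> real (card (nbh (present V b) x \<inter> nbh (present V b) y - best_cut V (detach (present V b) x y) x y)) < q ^ 3 * ?n / 16"
      using nb2 unfolding Un_iff case_prod_conv mem_Collect_eq not_less by simp
    then have "2 * \<zeta> \<le> real (card (nbh (present V b) x \<inter> nbh (present V b) y - best_cut V (detach (present V b) x y) x y))"
      unfolding \<zeta>_def by linarith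
    from defect_from_best_cut[OF E V(1) A this] no show False by simp
  qed
qed

subsection \<open>The main theorem\<close>

lemma container_family_size:
  fixes \<tau> :: real
  assumes \<tau>: "0 < \<tau>" "\<tau> \<le> 1"
    and k: "real k \<le> 3 * real N / \<tau>" and a: "real a \<le> 6 / \<tau> ^ 4"
  shows "(1 + (real N)\<^sup>2) ^ k * (1 + 2 ^ N) ^ a \<le> exp (3 * real N / \<tau> * ln (1 + (real N)\<^sup>2) + 6 / \<tau> ^ 4 * (real N + 1))"
proof -
  have "(2::real) \<le> exp 1" using exp_ge_add_one_self[of 1] by simp
  then have "(2::real) ^ N \<le> exp 1 ^ N" by (intro power_mono) auto
  also have "\<dots> = exp (real N)" by (simp flip: exp_of_nat_mult)
  finally have 2: "(2::real) ^ N \<le> exp (real N)" .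
  have "1 + (2::real) ^ N \<le> 2 * 2 ^ N" by simp
  also have "\<dots> \<le> exp 1 * exp (real N)" using 2 \<open>(2::real) \<le> exp 1\<close> by (intro mult_mono) auto
  also have "\<dots> = exp (real N + 1)" by (simp add: exp_add)
  finally have "(1 + 2 ^ N) ^ a \<le> exp (real N + 1) ^ a" by (intro power_mono) auto
  also have "\<dots> = exp (real a * (real N + 1))" by (rule exp_of_nat_mult[symmetric])
  also have "\<dots> \<le> exp (6 / \<tau> ^ 4 * (real N + 1))" using a by (simp only: exp_le_cancel_iff) (intro mult_right_mono, auto)
  finally have A: "(1 + 2 ^ N) ^ a \<le> exp (6 / \<tau> ^ 4 * (real N + 1))" .
  have pos: "1 + (real N)\<^sup>2 > 0" by (simp add: add_pos_nonneg)
  have "(1 + (real N)\<^sup>2) ^ k = exp (real k * ln (1 + (real N)\<^sup>2))"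
    using pos by (simp only: exp_of_nat_mult exp_ln)
  also have "\<dots> \<le> exp (3 * real N / \<tau> * ln (1 + (real N)\<^sup>2))"
    using k by (simp only: exp_le_cancel_iff) (intro mult_right_mono ln_ge_zero, auto)
  finally show ?thesis using A unfolding exp_add by (intro mult_mono) auto
qed

text \<open>The summands bound, in this order, the failure of the edge counts in containers and
  cuts, of \<open>dense_pairs\<close>, of \<open>matching\<close> and of
  \<open>defect\<close>.\<close>

lemma typical_graph_prob:
  fixes V :: "'a set" and p q \<tau> k0 t0 :: real
  assumes V: "finite V" "card V \<ge> 4" and pq: "0 < q" "q \<le> p" "p \<le> 1" and \<tau>: "0 < \<tau>" "\<tau> \<le> 1"
    and par: "12 * \<tau> / q < q / 2 * (q\<^sup>2 / 320)\<^sup>2" "t0 \<le> q\<^sup>2 / 320 * card V"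
      "q * t0 \<ge> 32 * k0" "6 * k0 * t0 < q ^ 3 * card V / 32"
    and par': "k0 > 0" "t0 > 0" "q\<^sup>2 * t0 \<ge> 8 * ln (card V)" "q ^ 4 * k0 \<ge> 20"
      "q ^ 4 * card V \<ge> 40 * ln (card V)" "4 * \<tau> * (real (card V))\<^sup>2 \<ge> 1"
  shows "measure_pmf.prob (edge_bits V p) {b. \<not> typical_graph V (present V b) p q \<tau> k0 t0 (q ^ 3 * card V / 32)}
    \<le> (exp (3 * real (card V) / \<tau> * ln (1 + (real (card V))\<^sup>2) + 6 / \<tau> ^ 4 * (real (card V) + 1)) + exp (real (card V)))
         * (2 * exp (- 2 * \<tau>\<^sup>2 * (real (card V))\<^sup>2))
      + 2 / card V + 2 * (real (card V))\<^sup>2 * exp (- (card V / 4))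
      + (real (card V))\<^sup>2 * (8 * exp (- (q ^ 4 * card V / 36)))"
proof -
  let ?n = "real (card V)"
  let ?P = "edge_bits V p"
  let ?\<zeta> = "q ^ 3 * card V / 32"
  \<comment> \<open>With \<open>k\<close> at most \<open>3 * ?n / \<tau>\<close>, the edges of
    \<open>H\<close> outside its container number at most
    \<open>3 / 2 * \<tau> * ?n\<^sup>2\<close>. The value \<open>4 / \<tau> ^ 4\<close> in
    \<open>a\<close> is \<open>1 / \<mu>\<^sup>2\<close>.\<close>
  define \<mu> where "\<mu> = \<tau>\<^sup>2 / 2"
  define k where "k = nat \<lceil>?n / \<tau>\<rceil> + 1"
  define a where "a = nat \<lceil>4 / \<tau> ^ 4\<rceil> + 1"
  have V0: "V \<noteq> {}" using V by auto
  have n: "?n \<ge> 4" using V by simp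
  have p: "0 \<le> p" "p \<le> 1" using pq by auto
  have \<mu>: "\<mu> > 0" using \<tau> by (simp add: \<mu>_def)
  have kl: "real k > ?n / \<tau>" unfolding k_def by linarith
  have "?n / \<tau> \<ge> 4" using n \<tau> by (simp add: field_simps)
  then have ku: "real k \<le> 3 * ?n / \<tau>" unfolding k_def by linarith
  have al: "real a > 4 / \<tau> ^ 4" unfolding a_def by linarith
  have "\<tau> ^ 4 \<le> 1" using \<tau> by (simp add: power_le_one)
  then have "4 / \<tau> ^ 4 \<ge> 4" using \<tau> by (simp add: field_simps)
  then have au: "real a \<le> 6 / \<tau> ^ 4" unfolding a_def by linarith
  have k: "real k * \<tau> > ?n" using kl \<tau> by (simp add: field_simps)
  have "real a * \<mu>\<^sup>2 = real a * \<tau> ^ 4 / 4" by (simp add: \<mu>_def power2_eq_square power4_eq_xxxx)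
  moreover have "real a * \<tau> ^ 4 > 4" using al \<tau> by (simp add: field_simps)
  ultimately have a: "real a * \<mu>\<^sup>2 > 1" by linarith
  have loss: "real k * (\<mu> * ?n) \<le> 2 * \<tau> * ?n\<^sup>2"
  proof -
    have "real k * (\<mu> * ?n) \<le> 3 * ?n / \<tau> * (\<mu> * ?n)" using ku \<mu> by (intro mult_right_mono) auto
    also have "\<dots> = 3 / 2 * (\<tau> * ?n\<^sup>2)" using \<tau> by (simp add: \<mu>_def power2_eq_square)
    also have "\<dots> \<le> 2 * \<tau> * ?n\<^sup>2" using \<tau> by simp
    finally show ?thesis .
  qed
  obtain \<F> where F: "finite \<F>" "card \<F> \<le> (1 + (card V)\<^sup>2) ^ k * (1 + 2 ^ card V) ^ a"
    "\<And>C. C \<in> \<F> \<Longrightarrow> C \<subseteq> nsets V 2"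
    and cont: "\<And>H. H \<subseteq> nsets V 2 \<Longrightarrow> tri_free H \<Longrightarrow>
       \<exists>C\<in>\<F>. real (card (H - C)) \<le> real k * (\<mu> * card V) \<and>
         (\<forall>v\<in>V. real (card (C \<inter> Pow (nbh C v))) \<le> \<tau> * (card V)\<^sup>2)"
    using containers[OF V(1) V0 \<tau>(1) \<mu> a k] by metis
  \<comment> \<open>With all cuts of the complete graph included, one union bound serves the
    containers and both cut conditions.\<close>
  define \<G> where "\<G> = \<F> \<union> cut (nsets V 2) ` Pow V"
  have G: "finite \<G>" "\<And>C. C \<in> \<G> \<Longrightarrow> C \<subseteq> nsets V 2"
    using F V(1) cut_subset by (auto simp: \<G>_def)
  have "card \<G> \<le> card \<F> + card (cut (nsets V 2) ` Pow V)"
    unfolding \<G>_def by (rule card_Un_le)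
  also have "card (cut (nsets V 2) ` Pow V) \<le> 2 ^ card V"
    using card_image_le[of "Pow V" "cut (nsets V 2)"] V(1) by (simp add: card_Pow)
  finally have "card \<G> \<le> (1 + (card V)\<^sup>2) ^ k * (1 + 2 ^ card V) ^ a + 2 ^ card V" using F(2) by simp
  then have "real (card \<G>) \<le> real ((1 + (card V)\<^sup>2) ^ k * (1 + 2 ^ card V) ^ a + 2 ^ card V)" by (rule of_nat_mono)
  also have "\<dots> = (1 + ?n\<^sup>2) ^ k * (1 + 2 ^ card V) ^ a + 2 ^ card V" by simp
  also have "\<dots> \<le> exp (3 * ?n / \<tau> * ln (1 + ?n\<^sup>2) + 6 / \<tau> ^ 4 * (?n + 1)) + exp ?n"
  proof (rule add_mono)
    show "(1 + ?n\<^sup>2) ^ k * (1 + 2 ^ card V) ^ a \<le> exp (3 * ?n / \<tau> * ln (1 + ?n\<^sup>2) + 6 / \<tau> ^ 4 * (?n + 1))"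
      using container_family_size[OF \<tau> ku au] .
    have "(2::real) \<le> exp 1" using exp_ge_add_one_self[of 1] by simp
    then have "(2::real) ^ card V \<le> exp 1 ^ card V" by (intro power_mono) auto
    then show "(2::real) ^ card V \<le> exp ?n" by (simp flip: exp_of_nat_mult)
  qed
  finally have cG: "real (card \<G>) \<le> exp (3 * ?n / \<tau> * ln (1 + ?n\<^sup>2) + 6 / \<tau> ^ 4 * (?n + 1)) + exp ?n" .
  let ?B1 = "{b. \<exists>C\<in>\<G>. \<bar>real (card (present V b \<inter> C)) - p * card C\<bar> > \<tau> * ?n\<^sup>2}"
  let ?B2 = "{b. \<not> (\<forall>S T. S \<subseteq> V \<longrightarrow> T \<subseteq> V \<longrightarrow> S \<inter> T = {} \<longrightarrow> card S = card T \<longrightarrow>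
      real (card S) \<ge> t0 \<longrightarrow> real (card (between (present V b) S T)) \<ge> q / 2 * (real (card S))\<^sup>2)}"
  let ?B3 = "{b. \<not> (\<forall>A M. A \<subseteq> V \<longrightarrow> real (card (V - A)) \<ge> card V / 5 \<longrightarrow>
      M \<subseteq> nsets A 2 \<longrightarrow> pairwise disjnt M \<longrightarrow> real (card M) \<ge> k0 \<longrightarrow>
      real (card {(e, z). e \<in> M \<and> z \<in> V - A \<and> (\<forall>x\<in>e. {x, z} \<in> present V b)}) \<ge> q\<^sup>2 / 20 * card M * card V)}"
  let ?B4 = "{b. \<not> (\<forall>A x y. A \<subseteq> V \<longrightarrow> x \<in> A \<longrightarrow> y \<in> A \<longrightarrow> x \<noteq> y \<longrightarrow>
      real (card (nbh (present V b) x \<inter> nbh (present V b) y - A)) < ?\<zeta> \<longrightarrow>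
      (\<exists>X\<subseteq>V. real (card (cut (present V b) X)) \<ge> real (card (cut (present V b) A)) + ?\<zeta>))}"
  have "measure_pmf.prob ?P ?B1 \<le> card \<G> * (2 * exp (- 2 * \<tau>\<^sup>2 * ?n\<^sup>2))"
    by (rule family_concentration[OF V(1) V0 p \<tau>(1) G])
  also have "\<dots> \<le> (exp (3 * ?n / \<tau> * ln (1 + ?n\<^sup>2) + 6 / \<tau> ^ 4 * (?n + 1)) + exp ?n) * (2 * exp (- 2 * \<tau>\<^sup>2 * ?n\<^sup>2))"
    using cG by (intro mult_right_mono) auto
  finally have B1: "measure_pmf.prob ?P ?B1 \<le> (exp (3 * ?n / \<tau> * ln (1 + ?n\<^sup>2) + 6 / \<tau> ^ 4 * (?n + 1)) + exp ?n)
      * (2 * exp (- 2 * \<tau>\<^sup>2 * ?n\<^sup>2))" .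
  note B2 = dense_pairs_prob[OF V(1) V0 pq par'(2,3)]
  note matching_prob[OF V(1) V0 pq par'(4,5)]
  \<comment> \<open>By \<open>ln 2 \<le> 3 / 4\<close>, a quarter of the exponent survives the
    factor \<open>2 ^ card V\<close>.\<close>
  also have "2 * ?n\<^sup>2 * 2 ^ card V * exp (- ?n) \<le> 2 * ?n\<^sup>2 * exp (- (?n / 4))"
  proof -
    have "(2::real) ^ card V = exp (?n * ln 2)" by (simp add: exp_of_nat_mult)
    then have "2 ^ card V * exp (- ?n) = exp (?n * ln 2 - ?n)" by (simp add: exp_diff exp_minus field_simps)
    moreover have "?n * ln 2 \<le> ?n * (3 / 4)" using ln2_le_25_over_36 by (intro mult_left_mono) auto
    ultimately have "2 ^ card V * exp (- ?n) \<le> exp (- (?n / 4))" by simp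
    then show ?thesis unfolding mult.assoc by (intro mult_left_mono) auto
  qed
  finally have B3: "measure_pmf.prob ?P ?B3 \<le> 2 * ?n\<^sup>2 * exp (- (?n / 4))" .
  note B4 = defect_prob[OF V pq]
  have sub: "measure_pmf.prob ?P (A \<union> B) \<le> measure_pmf.prob ?P A + measure_pmf.prob ?P B" for A B
    by (rule measure_Un_le) auto
  have bound: "measure_pmf.prob ?P (?B1 \<union> ?B2 \<union> ?B3 \<union> ?B4) \<le>
    measure_pmf.prob ?P ?B1 + measure_pmf.prob ?P ?B2 + measure_pmf.prob ?P ?B3 + measure_pmf.prob ?P ?B4"
    using sub[of "?B1 \<union> ?B2 \<union> ?B3" ?B4] sub[of "?B1 \<union> ?B2" ?B3] sub[of ?B1 ?B2] by linarith
  have "{b. \<not> typical_graph V (present V b) p q \<tau> k0 t0 ?\<zeta>} \<subseteq> ?B1 \<union> ?B2 \<union> ?B3 \<union> ?B4"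
  proof (rule subsetI, rule ccontr)
    fix b
    assume nt: "b \<in> {b. \<not> typical_graph V (present V b) p q \<tau> k0 t0 ?\<zeta>}"
      and nb: "b \<notin> ?B1 \<union> ?B2 \<union> ?B3 \<union> ?B4"
    let ?E = "present V b"
    have nb4: "b \<notin> ?B4" by (rule contrapos_nn[OF nb], rule UnI2)
    have nb3: "b \<notin> ?B3" by (rule contrapos_nn[OF nb], rule UnI1, rule UnI2)
    have nb2: "b \<notin> ?B2" by (rule contrapos_nn[OF nb], rule UnI1, rule UnI1, rule UnI2)
    have nb1: "b \<notin> ?B1" by (rule contrapos_nn[OF nb], rule UnI1, rule UnI1, rule UnI1)
    have conc: "\<bar>real (card (?E \<inter> C)) - p * card C\<bar> \<le> \<tau> * ?n\<^sup>2" if "C \<in> \<G>" for C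
      using nb1 that by (auto simp: not_less)
    have cutE: "cut ?E A = ?E \<inter> cut (nsets V 2) A" for A by (auto simp: cut_def)
    have cutc: "card (cut (nsets V 2) A) = card A * card (V - A)" if "A \<subseteq> V" for A
      using card_between_complete[of A V "V - A"] that cut_eq_between[of "nsets V 2" V A] by auto
    have cutG: "\<bar>real (card (cut ?E A)) - p * (real (card A) * real (card (V - A)))\<bar> \<le> \<tau> * ?n\<^sup>2" if A: "A \<subseteq> V" for A
    proof -
      have "cut (nsets V 2) A \<in> \<G>" using A by (auto simp: \<G>_def)
      from conc[OF this] show ?thesis unfolding cutE cutc[OF A] by simp
    qed
    have "typical_graph V ?E p q \<tau> k0 t0 ?\<zeta>"
    proof (unfold_locales)
      show "real (card (cut ?E A)) \<le> p * (real (card A) * real (card (V - A))) + \<tau> * ?n\<^sup>2" if "A \<subseteq> V" for A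
        using cutG[OF that] by linarith
      show "\<exists>A\<subseteq>V. p * ?n\<^sup>2 / 4 - 2 * \<tau> * ?n\<^sup>2 \<le> real (card (cut ?E A))"
      proof -
        \<comment> \<open>A balanced cut. Parity costs at most \<open>p / 4\<close>, which the
          second \<open>\<tau> * ?n\<^sup>2\<close> absorbs because
          \<open>4 * \<tau> * ?n\<^sup>2 \<ge> 1\<close>.\<close>
        obtain A where A: "A \<subseteq> V" "card A = card V div 2"
          using obtain_subset_with_card_n[of "card V div 2" V] by (metis div_le_dividend)
        have cVA: "card (V - A) = card V - card V div 2"
          using A V(1) by (simp add: card_Diff_subset finite_subset)
        have "4 * (real (card A) * real (card (V - A))) \<ge> ?n\<^sup>2 - 1"
        proof (cases "even (card V)")
          case True
          then obtain m where "card V = 2 * m" by blast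
          then show ?thesis using A cVA by (simp add: power2_eq_square)
        next
          case False
          then obtain m where "card V = 2 * m + 1" by (rule oddE)
          then show ?thesis using A cVA by (simp add: power2_eq_square algebra_simps)
        qed
        then have "p * ((?n\<^sup>2 - 1) / 4) \<le> p * (real (card A) * real (card (V - A)))"
          using pq by (intro mult_left_mono) auto
        moreover have "p * ((?n\<^sup>2 - 1) / 4) = p * ?n\<^sup>2 / 4 - p / 4" by (simp add: field_simps)
        ultimately have "p * ?n\<^sup>2 / 4 - 2 * \<tau> * ?n\<^sup>2 \<le> real (card (cut ?E A))"
          using cutG[OF A(1)] pq par'(6) by linarith
        then show ?thesis using A(1) by blast
      qed
      show "\<exists>C\<subseteq>nsets V 2. real (card (H - C)) \<le> 2 * \<tau> * ?n\<^sup>2 \<and>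
          (\<forall>v\<in>V. real (card (C \<inter> Pow (nbh C v))) \<le> \<tau> * ?n\<^sup>2) \<and>
          real (card (?E \<inter> C)) \<le> p * real (card C) + \<tau> * ?n\<^sup>2" if H: "H \<subseteq> ?E" "tri_free H" for H
      proof -
        have "H \<subseteq> nsets V 2" using H(1) by blast
        from cont[OF this H(2)] obtain C where C: "C \<in> \<F>" "real (card (H - C)) \<le> real k * (\<mu> * card V)"
          "\<forall>v\<in>V. real (card (C \<inter> Pow (nbh C v))) \<le> \<tau> * (card V)\<^sup>2" by (elim bexE conjE)
        have "C \<in> \<G>" using C(1) by (simp add: \<G>_def)
        from conc[OF this] have "real (card (?E \<inter> C)) \<le> p * real (card C) + \<tau> * ?n\<^sup>2" by linarith
        moreover have "\<forall>v\<in>V. real (card (C \<inter> Pow (nbh C v))) \<le> \<tau> * ?n\<^sup>2" using C(3) by simp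
        moreover have "real (card (H - C)) \<le> 2 * \<tau> * ?n\<^sup>2" using C(2) loss by linarith
        ultimately show ?thesis using F(3)[OF C(1)] by blast
      qed
      show "q / 2 * (real (card S))\<^sup>2 \<le> real (card (between ?E S T))"
        if "S \<subseteq> V" "T \<subseteq> V" "S \<inter> T = {}" "card S = card T" "t0 \<le> real (card S)" for S T
        using nb2 that by simp
      show "q\<^sup>2 / 20 * real (card M) * ?n \<le> real (card {(e, z). e \<in> M \<and> z \<in> V - A \<and> (\<forall>x\<in>e. {x, z} \<in> ?E)})"
        if "A \<subseteq> V" "?n / 5 \<le> real (card (V - A))" "M \<subseteq> nsets A 2" "pairwise disjnt M" "k0 \<le> real (card M)" for A M
        using nb3 that unfolding mem_Collect_eq not_not by blast
      show "\<exists>X\<subseteq>V. real (card (cut ?E A)) + ?\<zeta> \<le> real (card (cut ?E X))"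
        if "A \<subseteq> V" "x \<in> A" "y \<in> A" "x \<noteq> y" "real (card (nbh ?E x \<inter> nbh ?E y - A)) < ?\<zeta>" for A x y
        using nb4 that unfolding mem_Collect_eq not_not by blast
    qed (use V V0 pq \<tau> par par' in auto)
    then show False using nt by simp
  qed
  from prob_mono[OF this bound] add_mono[OF add_mono[OF add_mono[OF B1 B2] B3] B4]
  show ?thesis by (rule order.trans)
qed

text \<open>Every cut is a triangle-free subgraph, so no cut has more edges than \<open>H\<close>,
  and \<open>maximum_triangle_free_is_cut\<close> applies.\<close>

lemma (in typical_graph) max_triangle_free_subgraph_bipartite:
  assumes H: "max_triangle_free_subgraph H (V, E)"
  shows "bipartite H"
proof -
  have sub: "subgraph H (V, E)" "triangle_free H"
    and opt: "\<And>H'. subgraph H' (V, E) \<Longrightarrow> triangle_free H' \<Longrightarrow> \<not> card (edges H) < card (edges H')"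
    using H by (auto simp: max_triangle_free_subgraph_def is_arg_max_def)
  have HE: "edges H \<subseteq> E" "edges H \<subseteq> nsets (verts H) 2" "verts H \<subseteq> V"
    using sub(1) by (auto simp: subgraph_def simple_graph_def)
  have ne: "x \<noteq> y" if "{x, y} \<in> F" "F \<subseteq> nsets V 2" for x y F
    using subsetD[OF that(2,1)] by simp
  have tf: "tri_free (edges H)"
    unfolding tri_free_def
  proof (intro allI impI notI)
    fix x y z assume xyz: "{x, y} \<in> edges H" "{x, z} \<in> edges H" "{y, z} \<in> edges H"
    then have "distinct [x, y, z]" using ne[of _ _ "edges H"] HE(1) E by auto
    then show False using xyz sub(2) unfolding triangle_free_def by blast
  qed
  have "card (cut E X) \<le> card (edges H)" if X: "X \<subseteq> V" for X
  proof -
    have "subgraph (V, cut E X) (V, E)"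
      using cut_subset[of E X] E by (auto simp: subgraph_def simple_graph_def)
    moreover have "triangle_free (V, cut E X)"
      using tri_free_cut[of E X] unfolding triangle_free_def tri_free_def by (auto simp: insert_commute)
    ultimately show ?thesis using opt[of "(V, cut E X)"] by simp
  qed
  from maximum_triangle_free_is_cut[OF HE(1) tf this]
  obtain A where A: "A \<subseteq> V" "edges H = cut (edges H) A" by blast
  show ?thesis
    unfolding bipartite_def
  proof (intro exI conjI ballI)
    \<comment> \<open>\<open>H\<close> need not be spanning, so the parts are restricted to its own
      vertices.\<close>
    show "verts H \<inter> A \<union> (verts H - A) = verts H" by blast
    show "verts H \<inter> A \<inter> (verts H - A) = {}" by blast
    fix e assume e: "e \<in> edges H"
    then obtain x y where xy: "e = {x, y}" "x \<in> verts H" "y \<in> verts H" using edgeE[OF HE(2)] by blast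
    have "{x, y} \<in> cut (edges H) A" using e A(2) xy by simp
    then have "x \<in> A \<longleftrightarrow> y \<notin> A" by (simp add: doubleton_in_cut)
    then show "\<exists>x\<in>verts H \<inter> A. \<exists>y\<in>verts H - A. e = {x, y}"
      using xy by (cases "x \<in> A") (auto simp: insert_commute)
  qed
qed

theorem theorem1p3:
  "\<exists>c::real. c > 0 \<and>
     (\<forall>p :: nat \<Rightarrow> real.
        (\<forall>n\<ge>1. real n powr (- c) \<le> p n \<and> p n \<le> 1) \<longrightarrow>
        (\<lambda>n. measure_pmf.prob (random_graph n (p n))
               {G. \<forall>H. max_triangle_free_subgraph H G \<longrightarrow> bipartite H})
          \<longlonglongrightarrow> 1)"
proof (intro exI conjI allI impI)
  \<comment> \<open>The strongest demand comes from the container count: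
    \<open>6 / \<tau> ^ 4 * n\<close> must be far below \<open>\<tau>\<^sup>2 * n\<^sup>2\<close>.
    With \<open>\<tau> = q ^ 7\<close> this asks that \<open>q ^ 42 * n\<close> tends to infinity,
    for which any exponent below \<open>1 / 42\<close> is enough.\<close>
  show "(1 / 100 :: real) > 0" by simp
  fix p :: "nat \<Rightarrow> real"
  assume p: "\<forall>n\<ge>1. real n powr (- (1 / 100)) \<le> p n \<and> p n \<le> 1"
  define q where "q = (\<lambda>n. real n powr (- (1 / 100)))"
  define err where "err = (\<lambda>n. (exp (3 * real n / q n ^ 7 * ln (1 + (real n)\<^sup>2) + 6 / (q n ^ 7) ^ 4 * (real n + 1)) + exp (real n))
         * (2 * exp (- 2 * (q n ^ 7)\<^sup>2 * (real n)\<^sup>2))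
      + 2 / real n + 2 * (real n)\<^sup>2 * exp (- (real n / 4))
      + (real n)\<^sup>2 * (8 * exp (- (q n ^ 4 * real n / 36))))"
  have err: "err \<longlonglongrightarrow> 0" unfolding err_def q_def by real_asymp
  let ?prob = "\<lambda>n. measure_pmf.prob (random_graph n (p n)) {G. \<forall>H. max_triangle_free_subgraph H G \<longrightarrow> bipartite H}"
  \<comment> \<open>The scales are \<open>\<tau> = q ^ 7\<close>, \<open>k0 = 1 / q ^ 5\<close> and
    \<open>t0 = 1 / q ^ 7\<close>. As \<open>q\<close> tends to 0 more slowly than any of the powers
    of \<open>n\<close> involved, each condition compares powers of \<open>q\<close>,
    \<open>n\<close> and \<open>ln n\<close>.\<close>
  have "eventually (\<lambda>n. 12 * q n ^ 7 / q n < q n / 2 * ((q n)\<^sup>2 / 320)\<^sup>2) sequentially"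
    unfolding q_def by real_asymp
  moreover have "eventually (\<lambda>n. 1 / q n ^ 7 \<le> (q n)\<^sup>2 / 320 * real n) sequentially"
    unfolding q_def by real_asymp
  moreover have "eventually (\<lambda>n. 32 * (1 / q n ^ 5) \<le> q n * (1 / q n ^ 7)) sequentially"
    unfolding q_def by real_asymp
  moreover have "eventually (\<lambda>n. 6 * (1 / q n ^ 5) * (1 / q n ^ 7) < q n ^ 3 * real n / 32) sequentially"
    unfolding q_def by real_asymp
  moreover have "eventually (\<lambda>n. 8 * ln (real n) \<le> (q n)\<^sup>2 * (1 / q n ^ 7)) sequentially"
    unfolding q_def by real_asymp
  moreover have "eventually (\<lambda>n. 20 \<le> q n ^ 4 * (1 / q n ^ 5)) sequentially"
    unfolding q_def by real_asymp
  moreover have "eventually (\<lambda>n. 40 * ln (real n) \<le> q n ^ 4 * real n) sequentially"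
    unfolding q_def by real_asymp
  moreover have "eventually (\<lambda>n. 1 \<le> 4 * q n ^ 7 * (real n)\<^sup>2) sequentially"
    unfolding q_def by real_asymp
  ultimately have lower: "eventually (\<lambda>n. 1 - err n \<le> ?prob n) sequentially"
    using eventually_ge_at_top[of 4]
  proof eventually_elim
    case (elim n)
    let ?V = "{1..n}"
    have pn: "q n \<le> p n" "p n \<le> 1" using p elim(9) by (auto simp: q_def)
    have qn: "0 < q n" using elim(9) by (simp add: q_def)
    then have q1: "q n \<le> 1" using pn by simp
    have "measure_pmf.prob (edge_bits ?V (p n)) {b. \<not> typical_graph ?V (present ?V b) (p n) (q n) (q n ^ 7) (1 / q n ^ 5) (1 / q n ^ 7) (q n ^ 3 * card ?V / 32)} \<le> err n"
      using typical_graph_prob[of ?V "q n" "p n" "q n ^ 7" "1 / q n ^ 7" "1 / q n ^ 5"] elim qn q1 pn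
      by (simp add: err_def power_le_one)
    moreover have "measure_pmf.prob (edge_bits ?V (p n)) {b. \<not> typical_graph ?V (present ?V b) (p n) (q n) (q n ^ 7) (1 / q n ^ 5) (1 / q n ^ 7) (q n ^ 3 * card ?V / 32)}
      = 1 - measure_pmf.prob (edge_bits ?V (p n)) {b. typical_graph ?V (present ?V b) (p n) (q n) (q n ^ 7) (1 / q n ^ 5) (1 / q n ^ 7) (q n ^ 3 * card ?V / 32)}"
      by (subst measure_pmf.prob_compl[symmetric]) (auto intro!: arg_cong2[where f = measure])
    moreover have "measure_pmf.prob (edge_bits ?V (p n)) {b. typical_graph ?V (present ?V b) (p n) (q n) (q n ^ 7) (1 / q n ^ 5) (1 / q n ^ 7) (q n ^ 3 * card ?V / 32)} \<le> ?prob n"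
      unfolding random_graph_def measure_map_pmf
      by (rule measure_pmf.finite_measure_mono) (auto dest: typical_graph.max_triangle_free_subgraph_bipartite)
    ultimately show ?case by linarith
  qed
  have "(\<lambda>n. 1 - err n) \<longlonglongrightarrow> 1" using tendsto_diff[OF tendsto_const[of 1] err] by simp
  from tendsto_sandwich[OF lower _ this tendsto_const] show "?prob \<longlonglongrightarrow> 1"
    by (simp add: measure_pmf.prob_le_1)
qed

end
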